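(* Let $p$ be a prime, $k$ the finite field with $p$ elements, $K=k(\!(T)\!)$, and let $x=(f_0(T),f_1(T),\dots)\in W(K)^\times$. Then there exist $c\in k^\times$, elements $c_{jk}\in k$ (for integers $k\ge0$ and positive integers $j$ with $(j,p)=1$), and integers $k_{i_1,i_2}\in\{0,1,\dots,p-1\}$ (for integers $i_2\ge2$ and integers $i_1$ bounded below, the bound depending on $i_2$) such that $$x=[cT^d]\cdot\prod_{k=0}^\infty\prod_{(j,p)=1}[1-c_{jk}T^j]^{p^k}\cdot\prod_{i_2=2}^\infty\prod_{i_1}u_{i_1,i_2}^{k_{i_1,i_2}},$$ where $d=v_T(f_0(T))$ and the infinite products converge componentwise $T$-adically in $W(K)^\times$.
   Context: $W(K)$ is the ring of $p$-typical Witt vectors over $K$, $W(K)^\times$ its unit group, $[\,\cdot\,]$ the Teichmüller lift, $V$ the Verschiebung $V(x_0,x_1,\dots)=(0,x_0,x_1,\dots)$, and for integers $m$ and $n\ge2$, $u_{m,n}=1+V^{n-1}[T^m]\in W(K)^\times$ (so its truncation to length $n$ is $(1,0,\dots,0,T^m)$). $v_T$ is the $T$-adic valuation on $K$. *)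

theory Defs
  imports
    "HOL-Algebra.Ring"
    "HOL-Library.Cardinality"
    "HOL-Library.Poly_Mapping"
    "HOL-Computational_Algebra.Formal_Laurent_Series"
begin

definition ghost :: "nat \<Rightarrow> (nat \<Rightarrow> 'a::comm_semiring_1) \<Rightarrow> nat \<Rightarrow> 'a" where
  "ghost p x n = (\<Sum>i\<le>n. of_nat (p ^ i) * x i ^ (p ^ (n - i)))"

text \<open>
  The integral polynomial ring in two sequences of indeterminates: \<open>Inl i\<close> is the index of
  \<open>X\<^sub>i\<close> and \<open>Inr i\<close> that of \<open>Y\<^sub>i\<close>; monomials are finitely supported exponent functions.
\<close>

type_synonym xy_poly = "((nat + nat) \<Rightarrow>\<^sub>0 nat) \<Rightarrow>\<^sub>0 int"

definition xy_var :: "nat + nat \<Rightarrow> xy_poly" where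
  "xy_var v = Poly_Mapping.single (Poly_Mapping.single v 1) 1"

definition xy_eval :: "(nat + nat \<Rightarrow> 'a::comm_ring_1) \<Rightarrow> xy_poly \<Rightarrow> 'a" where
  "xy_eval s P =
     (\<Sum>m\<in>Poly_Mapping.keys P. of_int (Poly_Mapping.lookup P m) *
        (\<Prod>v\<in>Poly_Mapping.keys m. s v ^ Poly_Mapping.lookup m v))"

text \<open>
  For prime \<open>p\<close> the following are the unique sequences of integral polynomials whose ghost
  components are the sums, respectively the products, of the ghost components of \<open>X\<close> and \<open>Y\<close>.
\<close>

definition witt_add_poly :: "nat \<Rightarrow> nat \<Rightarrow> xy_poly" where
  "witt_add_poly p =
     (THE S. \<forall>n. ghost p S n =
        ghost p (\<lambda>i. xy_var (Inl i)) n + ghost p (\<lambda>i. xy_var (Inr i)) n)"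

definition witt_mult_poly :: "nat \<Rightarrow> nat \<Rightarrow> xy_poly" where
  "witt_mult_poly p =
     (THE M. \<forall>n. ghost p M n =
        ghost p (\<lambda>i. xy_var (Inl i)) n * ghost p (\<lambda>i. xy_var (Inr i)) n)"

definition witt_ring :: "nat \<Rightarrow> (nat \<Rightarrow> 'a::comm_ring_1) ring" where
  "witt_ring p =
     \<lparr>carrier = UNIV,
      monoid.mult = (\<lambda>x y n. xy_eval (case_sum x y) (witt_mult_poly p n)),
      one = (\<lambda>n. if n = 0 then 1 else 0),
      zero = (\<lambda>n. 0),
      add = (\<lambda>x y n. xy_eval (case_sum x y) (witt_add_poly p n))\<rparr>"

definition teichmueller :: "'a::comm_ring_1 \<Rightarrow> nat \<Rightarrow> 'a" where
  "teichmueller a = (\<lambda>n. if n = 0 then a else 0)"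

definition verschiebung :: "(nat \<Rightarrow> 'a::comm_ring_1) \<Rightarrow> nat \<Rightarrow> 'a" where
  "verschiebung x = (\<lambda>n. case n of 0 \<Rightarrow> 0 | Suc i \<Rightarrow> x i)"

definition witt_u :: "nat \<Rightarrow> int \<Rightarrow> nat \<Rightarrow> nat \<Rightarrow> 'k::field fls" where
  "witt_u p m n =
     \<one>\<^bsub>witt_ring p\<^esub> \<oplus>\<^bsub>witt_ring p\<^esub> (verschiebung ^^ (n - 1)) (teichmueller (fls_X powi m))"

text \<open>
  Convergence of a product in the unit group, as a limit of the net of finite partial products.
  The topology on \<open>'k fls\<close> is the library's, whose metric is the \<open>T\<close>-adic one.
\<close>

definition witt_has_prod ::
  "nat \<Rightarrow> ('i \<Rightarrow> nat \<Rightarrow> 'k::field fls) \<Rightarrow> 'i set \<Rightarrow> (nat \<Rightarrow> 'k fls) \<Rightarrow> bool" where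
  "witt_has_prod p f I x \<longleftrightarrow>
     f ` I \<subseteq> Units (witt_ring p) \<and> x \<in> Units (witt_ring p) \<and>
     (\<forall>n. ((\<lambda>F. finprod (witt_ring p) f F n) \<longlongrightarrow> x n) (finite_subsets_at_top I))"

end

theory Submission
  imports Defs
begin

unbundle fps_syntax

text \<open>
  The Teichmueller lift of the leading component splits off: \<open>x = [f\<^sub>0] y\<close> with \<open>y \<in> 1 + V W(K)\<close>.
  Writing \<open>f\<^sub>0 = c T\<^sup>d g\<close> with \<open>g \<equiv> 1\<close> mod \<open>T\<close>, one expands \<open>g = \<Prod>\<^sub>n (1 - a\<^sub>n T\<^sup>n)\<close> greedily; for
  \<open>n = j p\<^sup>k\<close> with \<open>j\<close> prime to \<open>p\<close> the \<open>n\<close>-th factor equals \<open>(1 - a\<^sub>n T\<^sup>j)\<close> to the power \<open>p\<^sup>k\<close>,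
  since \<open>a\<^sup>p = a\<close> in the prime field.

  On \<open>1 + V\<^sup>m W(K)\<close>, \<open>m \<ge> 1\<close>, multiplication is addition in the component with index \<open>m\<close>, where
  \<open>1 + V\<^sup>m [T\<^sup>i]\<close> has entry \<open>T\<^sup>i\<close>. So a suitable product of the \<open>u\<^bsub>i,m+1\<^esub>\<close> matches that component of
  \<open>y\<close>, the quotient lies in \<open>1 + V\<^sup>m\<^sup>+\<^sup>1 W(K)\<close>, and one iterates.

  Convergence rests on one observation: the Witt polynomials have integer coefficients, so
  multiplication of Witt vectors with components in \<open>k[[T]]\<close> respects componentwise congruence
  modulo \<open>T\<^sup>N\<close>. The finitely many factors with poles are harmless because multiplication is
  continuous.
\<close>

section \<open>Integral polynomials and their evaluation\<close>

text \<open>The type of variables is left open because two kinds occur: the \<open>nat + nat\<close>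
  of the Witt polynomials, and the elements of an arbitrary ring in
  \<open>witt_lift\<close>.\<close>

definition mono_eval :: "('v \<Rightarrow> 'a::comm_ring_1) \<Rightarrow> ('v \<Rightarrow>\<^sub>0 nat) \<Rightarrow> 'a" where
  "mono_eval s m = (\<Prod>v\<in>Poly_Mapping.keys m. s v ^ Poly_Mapping.lookup m v)"

definition poly_eval :: "('v \<Rightarrow> 'a::comm_ring_1) \<Rightarrow> (('v \<Rightarrow>\<^sub>0 nat) \<Rightarrow>\<^sub>0 int) \<Rightarrow> 'a" where
  "poly_eval s P =
     (\<Sum>m\<in>Poly_Mapping.keys P. of_int (Poly_Mapping.lookup P m) * mono_eval s m)"

definition poly_var :: "'v \<Rightarrow> (('v \<Rightarrow>\<^sub>0 nat) \<Rightarrow>\<^sub>0 int)" where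
  "poly_var v = Poly_Mapping.single (Poly_Mapping.single v 1) 1"

lemma xy_eval_eq_poly_eval: "xy_eval = poly_eval"
  by (intro ext) (simp add: xy_eval_def poly_eval_def mono_eval_def)

lemma xy_var_eq_poly_var: "xy_var = poly_var"
  by (intro ext) (simp add: xy_var_def poly_var_def)

text \<open>Serves monomials and polynomials alike, as both are finitely supported
  functions.\<close>

lemma poly_mapping_single_induct [case_names zero add]:
  assumes "P 0"
    and "\<And>f a b. P f \<Longrightarrow> P (Poly_Mapping.single a b + f)"
  shows "P (f :: 'a \<Rightarrow>\<^sub>0 'b::comm_monoid_add)"
proof (induction f rule: Poly_Mapping.update_induct)
  case (update f a b)
  have "Poly_Mapping.update a b f = Poly_Mapping.single a b + f"
    using update.hyps
    by (intro poly_mapping_eqI)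
      (auto simp: lookup_add lookup_single lookup_update in_keys_iff when_def)
  then show ?case
    using assms(2)[OF update.IH] by simp
qed (rule assms(1))

lemma mono_eval_superset:
  assumes "finite A" "Poly_Mapping.keys m \<subseteq> A"
  shows "mono_eval s m = (\<Prod>v\<in>A. s v ^ Poly_Mapping.lookup m v)"
  unfolding mono_eval_def
  by (rule prod.mono_neutral_left) (use assms in \<open>auto simp: in_keys_iff\<close>)

lemma mono_eval_0 [simp]: "mono_eval s 0 = 1"
  by (simp add: mono_eval_def)

lemma mono_eval_add: "mono_eval s (m + m') = mono_eval s m * mono_eval s m'"
proof -
  let ?A = "Poly_Mapping.keys m \<union> Poly_Mapping.keys m'"
  have "Poly_Mapping.keys (m + m') \<subseteq> ?A"
    by (rule Poly_Mapping.keys_add)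
  then show ?thesis
    by (simp add: mono_eval_superset[of ?A] lookup_add power_add prod.distrib)
qed

lemma mono_eval_single: "mono_eval s (Poly_Mapping.single v n) = s v ^ n"
  by (cases "n = 0") (simp_all add: mono_eval_def)

lemma mono_eval_power: "mono_eval (\<lambda>v. s v ^ n) m = mono_eval s m ^ n"
  by (simp add: mono_eval_def prod_power_distrib mult.commute flip: power_mult)

lemma poly_var_power:
  "poly_var v ^ n = Poly_Mapping.single (Poly_Mapping.single v n) 1"
  by (induction n) (simp_all add: poly_var_def mult_single flip: single_add)

lemma mono_eval_poly_var: "mono_eval poly_var m = Poly_Mapping.single m 1"
proof (induction m rule: poly_mapping_single_induct)
  case (add m v n)
  then show ?case
    by (simp add: mono_eval_add mono_eval_single poly_var_power mult_single)
qed simp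

lemma poly_eval_0 [simp]: "poly_eval s 0 = 0"
  by (simp add: poly_eval_def)

lemma poly_eval_add: "poly_eval s (P + Q) = poly_eval s P + poly_eval s Q"
  unfolding poly_eval_def
  by (rule setsum_keys_plus_distrib) (simp_all add: algebra_simps)

lemma poly_eval_single:
  "poly_eval s (Poly_Mapping.single m c) = of_int c * mono_eval s m"
  by (cases "c = 0") (simp_all add: poly_eval_def)

lemma poly_eval_mult: "poly_eval s (P * Q) = poly_eval s P * poly_eval s Q"
proof (induction P rule: poly_mapping_single_induct)
  case (add P m c)
  have "poly_eval s (Poly_Mapping.single m c * Q) = poly_eval s (Poly_Mapping.single m c) * poly_eval s Q"
  proof (induction Q rule: poly_mapping_single_induct)
    case (add Q m' c')
    then show ?case
      by (simp add: poly_eval_add poly_eval_single mult_single mono_eval_add algebra_simps)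
  qed simp
  with add show ?case
    by (simp add: poly_eval_add algebra_simps)
qed simp

lemma poly_eval_of_nat [simp]: "poly_eval s (of_nat n) = of_nat n"
  using poly_eval_single[of s 0 "int n"] by (simp flip: single_of_nat)

lemma poly_eval_of_int [simp]: "poly_eval s (of_int n) = of_int n"
  using poly_eval_single[of s 0 n] by (simp flip: single_of_int)

lemma poly_eval_1 [simp]: "poly_eval s 1 = 1"
  using poly_eval_of_nat[of s 1] by simp

lemma poly_eval_diff: "poly_eval s (P - Q) = poly_eval s P - poly_eval s Q"
  using poly_eval_add[of s "P - Q" Q] by (simp add: algebra_simps)

lemma poly_eval_power: "poly_eval s (P ^ n) = poly_eval s P ^ n"
  by (induction n) (simp_all add: poly_eval_mult)

lemma poly_eval_sum: "poly_eval s (\<Sum>i\<in>A. f i) = (\<Sum>i\<in>A. poly_eval s (f i))"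
  by (induction A rule: infinite_finite_induct) (simp_all add: poly_eval_add)

lemma poly_eval_prod: "poly_eval s (\<Prod>i\<in>A. f i) = (\<Prod>i\<in>A. poly_eval s (f i))"
  by (induction A rule: infinite_finite_induct) (simp_all add: poly_eval_mult)

lemma poly_eval_var [simp]: "poly_eval s (poly_var v) = s v"
  by (simp add: poly_var_def poly_eval_single mono_eval_single)

lemma poly_eval_poly_eval:
  "poly_eval t (poly_eval s P) = poly_eval (\<lambda>v. poly_eval t (s v)) P"
  by (simp add: poly_eval_def[of s] poly_eval_def[of "\<lambda>v. poly_eval t (s v)"] mono_eval_def
      poly_eval_sum poly_eval_mult poly_eval_prod poly_eval_power)

lemma lookup_of_nat_times:
  "Poly_Mapping.lookup (of_nat c * (P :: ('v \<Rightarrow>\<^sub>0 nat) \<Rightarrow>\<^sub>0 int)) m = int c * Poly_Mapping.lookup P m"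
  by (induction c) (simp_all add: algebra_simps lookup_add)

text \<open>Torsion-freeness of the integral polynomial ring, on which the injectivity of the ghost
  map rests.\<close>

lemma poly_of_nat_mult_left_cancel:
  fixes P Q :: "('v \<Rightarrow>\<^sub>0 nat) \<Rightarrow>\<^sub>0 int"
  assumes "of_nat c * P = of_nat c * Q" "c \<noteq> 0"
  shows "P = Q"
proof (rule poly_mapping_eqI)
  fix m
  show "Poly_Mapping.lookup P m = Poly_Mapping.lookup Q m"
    using arg_cong[OF assms(1), of "\<lambda>R. Poly_Mapping.lookup R m"] assms(2)
    by (simp add: lookup_of_nat_times)
qed


section \<open>Integrality of the Witt polynomials\<close>

lemma prime_dvd_add_power_diff:
  fixes a b :: "'a::comm_ring_1"
  assumes "prime p"
  shows "of_nat p dvd (a + b) ^ p - (a ^ p + b ^ p)"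
proof -
  have p: "p > 0"
    using assms prime_gt_0_nat by blast
  let ?g = "\<lambda>k. of_nat (p choose k) * a ^ k * b ^ (p - k)"
  have "(a + b) ^ p = (\<Sum>k\<le>p. ?g k)"
    by (rule binomial_ring)
  also have "{..p} = insert 0 (insert p {0<..<p})"
    using p by auto
  also have "sum ?g \<dots> = b ^ p + (a ^ p + sum ?g {0<..<p})"
    using p by simp
  finally have "(a + b) ^ p - (a ^ p + b ^ p) = sum ?g {0<..<p}"
    by (simp add: algebra_simps)
  moreover have "of_nat p dvd sum ?g {0<..<p}"
  proof (rule dvd_sum)
    fix k assume "k \<in> {0<..<p}"
    then have "p dvd (p choose k)"
      using assms by (intro dvd_choose_prime) auto
    then show "of_nat p dvd ?g k"
      by (auto elim!: dvdE simp: mult.assoc)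
  qed
  ultimately show ?thesis
    by simp
qed


text \<open>Fermat's little theorem, by induction from 0 in both directions:
  \<open>(c + 1) ^ p\<close> is congruent to \<open>c ^ p + 1\<close>.\<close>

lemma prime_dvd_int_power_diff:
  assumes "prime p"
  shows "int p dvd c ^ p - c"
proof -
  have step: "int p dvd (c + 1) ^ p - (c + 1) \<longleftrightarrow> int p dvd c ^ p - c" for c
  proof -
    have "(c + 1) ^ p - (c + 1) = ((c + 1) ^ p - (c ^ p + 1 ^ p)) + (c ^ p - c)"
      by simp
    then show ?thesis
      using prime_dvd_add_power_diff[OF assms, of c 1] by (metis dvd_add_right_iff)
  qed
  show ?thesis
  proof (induction c rule: int_induct[where k = 0])
    case base
    show ?case
      using assms prime_gt_0_nat by (simp add: power_0_left)
  next
    case (step1 i)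
    then show ?case
      using step[of i] by simp
  next
    case (step2 i)
    then show ?case
      using step[of "i - 1"] by simp
  qed
qed

text \<open>Substituting \<open>p\<close>-th powers for the variables lifts the Frobenius map. On a
  single term the claim is Fermat's theorem for the coefficient; both sides are additive modulo
  \<open>p\<close>.\<close>

lemma of_nat_prime_dvd_poly_frobenius_diff:
  fixes P :: "('v \<Rightarrow>\<^sub>0 nat) \<Rightarrow>\<^sub>0 int"
  assumes "prime p"
  shows "of_nat p dvd poly_eval (\<lambda>v. poly_var v ^ p) P - P ^ p"
proof (induction P rule: poly_mapping_single_induct)
  case zero
  show ?case
    using assms prime_gt_0_nat by (simp add: power_0_left)
next
  case (add P m c)
  let ?F = "poly_eval (\<lambda>v. poly_var v ^ p) :: _ \<Rightarrow> ('v \<Rightarrow>\<^sub>0 nat) \<Rightarrow>\<^sub>0 int"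
  let ?M = "Poly_Mapping.single m c"
  have M: "?M = of_int c * mono_eval poly_var m"
    by (simp add: mono_eval_poly_var mult_single flip: single_of_int)
  have "int p dvd c - c ^ p"
    using prime_dvd_int_power_diff[OF assms, of c] by (metis dvd_minus_iff minus_diff_eq)
  then have "of_nat p dvd (of_int (c - c ^ p) :: ('v \<Rightarrow>\<^sub>0 nat) \<Rightarrow>\<^sub>0 int)"
    by (metis of_int_mult of_int_of_nat_eq dvd_def)
  moreover have "?F ?M - ?M ^ p = of_int (c - c ^ p) * mono_eval poly_var m ^ p"
    by (simp add: poly_eval_single mono_eval_power) (simp add: M power_mult_distrib algebra_simps)
  ultimately have "of_nat p dvd ?F ?M - ?M ^ p"
    by simp
  from dvd_diff[OF dvd_add[OF this add.IH] prime_dvd_add_power_diff[OF assms, of ?M P]]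
  show ?case
    by (simp add: poly_eval_add algebra_simps)
qed

lemma of_nat_power_dvd_power_diff:
  fixes a b :: "'a::comm_ring_1"
  assumes "of_nat p dvd a - b"
  shows "of_nat (p ^ Suc k) dvd a ^ (p ^ k) - b ^ (p ^ k)"
proof (induction k)
  case (Suc k)
  define A B where "A = a ^ (p ^ k)" and "B = b ^ (p ^ k)"
  have "a - b dvd A - B"
    unfolding A_def B_def by (simp add: power_diff_sumr2)
  then have AB: "of_nat p dvd A - B"
    using assms dvd_trans by blast
  \<comment> \<open>The cofactor of \<open>A - B\<close> in \<open>A ^ p - B ^ p\<close> is
    congruent to \<open>p * B ^ (p - 1)\<close> modulo \<open>p\<close>, hence to 0, so each
    \<open>p\<close>-th power gains one factor \<open>p\<close>.\<close>
  have "(\<Sum>i<p. B ^ (p - Suc i) * A ^ i) - of_nat p * B ^ (p - 1) =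
      (\<Sum>i<p. B ^ (p - Suc i) * A ^ i - B ^ (p - Suc i) * B ^ i)"
    by (simp add: sum_subtractf flip: power_add)
  also have "of_nat p dvd \<dots>"
  proof (rule dvd_sum)
    fix i
    have "A - B dvd A ^ i - B ^ i"
      by (simp add: power_diff_sumr2)
    then show "of_nat p dvd B ^ (p - Suc i) * A ^ i - B ^ (p - Suc i) * B ^ i"
      using AB dvd_trans by (metis dvd_mult right_diff_distrib)
  qed
  finally have "of_nat p dvd (\<Sum>i<p. B ^ (p - Suc i) * A ^ i)"
    by (metis diff_add_cancel dvd_add dvd_triv_left)
  then have "of_nat (p ^ Suc k) * of_nat p dvd (A - B) * (\<Sum>i<p. B ^ (p - Suc i) * A ^ i)"
    using Suc.IH unfolding A_def B_def by (rule mult_dvd_mono[rotated])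
  moreover have "a ^ (p ^ Suc k) - b ^ (p ^ Suc k) = (A - B) * (\<Sum>i<p. B ^ (p - Suc i) * A ^ i)"
    unfolding A_def B_def power_Suc2[of p k] power_mult by (rule power_diff_sumr2)
  ultimately show ?case
    by (simp add: mult_ac)
qed (use assms in simp)


section \<open>Ghost components and the equations they satisfy\<close>

lemma ghost_eq:
  "ghost p x n = (\<Sum>i<n. of_nat (p ^ i) * x i ^ (p ^ (n - i))) + of_nat (p ^ n) * x n"
  by (simp add: ghost_def flip: lessThan_Suc_atMost)

lemma poly_eval_ghost: "poly_eval s (ghost p S n) = ghost p (\<lambda>i. poly_eval s (S i)) n"
  by (simp add: ghost_def poly_eval_sum poly_eval_mult poly_eval_power)

text \<open>
  Dwork's lemma for the Frobenius lift raising every variable to its \<open>p\<close>-th power.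
\<close>

lemma ghost_eqs_solvable:
  fixes a :: "nat \<Rightarrow> ('v \<Rightarrow>\<^sub>0 nat) \<Rightarrow>\<^sub>0 int"
  assumes "prime p"
    and a: "\<And>n. of_nat (p ^ Suc n) dvd a (Suc n) - poly_eval (\<lambda>v. poly_var v ^ p) (a n)"
  shows "\<exists>S. \<forall>n. ghost p S n = a n"
proof -
  let ?F = "poly_eval (\<lambda>v. poly_var v ^ p) :: _ \<Rightarrow> ('v \<Rightarrow>\<^sub>0 nat) \<Rightarrow>\<^sub>0 int"
  have "\<exists>S. \<forall>n. (\<Sum>i<n. of_nat (p ^ i) * S i ^ (p ^ (n - i))) + of_nat (p ^ n) * S n = a n"
  \<comment> \<open>The components \<open>S n\<close> are chosen one after another. Equation
    \<open>n\<close> is solvable for \<open>S n\<close> as soon as \<open>p ^ n\<close> divides what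
    the earlier terms leave of \<open>a n\<close>.\<close>
  proof (rule dependent_wellorder_choice)
    fix S :: "nat \<Rightarrow> ('v \<Rightarrow>\<^sub>0 nat) \<Rightarrow>\<^sub>0 int" and n
    assume IH: "\<And>m. m < n \<Longrightarrow>
      (\<Sum>i<m. of_nat (p ^ i) * S i ^ (p ^ (m - i))) + of_nat (p ^ m) * S m = a m"
    have "of_nat (p ^ n) dvd a n - (\<Sum>i<n. of_nat (p ^ i) * S i ^ (p ^ (n - i)))"
    proof (cases n)
      case (Suc m)
      \<comment> \<open>By hypothesis \<open>a n\<close> may be replaced by \<open>?F (a m)\<close>
        modulo \<open>p ^ n\<close>. This is the ghost component with \<open>?F (S i)\<close> where
        the terms to be subtracted have \<open>S i ^ p\<close>.\<close>
      have "?F (a m) = ghost p (\<lambda>i. ?F (S i)) m"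
        using IH[of m] Suc by (simp flip: poly_eval_ghost) (simp add: ghost_eq)
      then have "?F (a m) - (\<Sum>i<n. of_nat (p ^ i) * S i ^ (p ^ (n - i))) =
          (\<Sum>i<n. of_nat (p ^ i) * (?F (S i) ^ (p ^ (m - i)) - (S i ^ p) ^ (p ^ (m - i))))"
        by (simp add: Suc lessThan_Suc_atMost ghost_def sum_subtractf
            right_diff_distrib Suc_diff_le flip: power_mult power_Suc)
      also have "of_nat (p ^ n) dvd \<dots>"
      proof (rule dvd_sum)
        fix i assume "i \<in> {..<n}"
        \<comment> \<open>The coefficient contributes \<open>p ^ i\<close>, and the power
          \<open>p ^ (m - i)\<close> improves the congruence modulo \<open>p\<close> to one modulo
          \<open>p ^ Suc (m - i)\<close>.\<close>
        then have "p ^ n = p ^ i * p ^ Suc (m - i)"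
          by (simp add: Suc flip: power_add power_Suc)
        moreover have "of_nat (p ^ Suc (m - i)) dvd ?F (S i) ^ (p ^ (m - i)) - (S i ^ p) ^ (p ^ (m - i))"
          by (intro of_nat_power_dvd_power_diff of_nat_prime_dvd_poly_frobenius_diff assms(1))
        ultimately show "of_nat (p ^ n) dvd
            of_nat (p ^ i) * (?F (S i) ^ (p ^ (m - i)) - (S i ^ p) ^ (p ^ (m - i)))"
          by (simp only: of_nat_mult mult_dvd_mono dvd_refl)
      qed
      finally have "of_nat (p ^ n) dvd ?F (a m) - (\<Sum>i<n. of_nat (p ^ i) * S i ^ (p ^ (n - i)))" .
      from dvd_add[OF a[of m, folded Suc] this] show ?thesis
        by simp
    qed simp
    then obtain r where "a n - (\<Sum>i<n. of_nat (p ^ i) * S i ^ (p ^ (n - i))) = of_nat (p ^ n) * r"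
      by (elim dvdE)
    then show "\<exists>r. (\<Sum>i<n. of_nat (p ^ i) * S i ^ (p ^ (n - i))) + of_nat (p ^ n) * r = a n"
      by (intro exI[of _ r]) (simp add: algebra_simps)
  qed simp
  then show ?thesis
    by (simp add: ghost_eq)
qed

text \<open>Once the earlier components agree, ghost component \<open>m\<close> determines
  \<open>p ^ m * x m\<close>, and \<open>p ^ m\<close> cancels. The bound \<open>n\<close> is what
  \<open>wmult_diff\<close> and \<open>wadd_diff\<close> use.\<close>

lemma ghost_inject_below:
  fixes x y :: "nat \<Rightarrow> ('v \<Rightarrow>\<^sub>0 nat) \<Rightarrow>\<^sub>0 int"
  assumes "p \<noteq> 0" and "\<And>m. m < n \<Longrightarrow> ghost p x m = ghost p y m" and "m < n"
  shows "x m = y m"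
  using \<open>m < n\<close>
proof (induction m rule: less_induct)
  case (less m)
  have "ghost p x m = ghost p y m"
    by (rule assms(2)) fact
  moreover have "(\<Sum>i<m. of_nat (p ^ i) * x i ^ (p ^ (m - i))) =
      (\<Sum>i<m. of_nat (p ^ i) * y i ^ (p ^ (m - i)))"
    using less by (intro sum.cong) auto
  ultimately have "of_nat (p ^ m) * x m = of_nat (p ^ m) * y m"
    by (simp add: ghost_eq)
  then show ?case
    by (rule poly_of_nat_mult_left_cancel) (use assms in simp)
qed

lemma ghost_inject:
  fixes x y :: "nat \<Rightarrow> ('v \<Rightarrow>\<^sub>0 nat) \<Rightarrow>\<^sub>0 int"
  assumes "p \<noteq> 0" and "\<And>n. ghost p x n = ghost p y n"
  shows "x = y"
proof
  fix n show "x n = y n"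
    by (rule ghost_inject_below[of p "Suc n"]) (use assms in auto)
qed

text \<open>The substitution carries ghost component \<open>n\<close> of the variables to component
  \<open>n + 1\<close> without its last term, which is a multiple of
  \<open>p ^ Suc n\<close>.\<close>

lemma ghost_vars_Suc:
  fixes f :: "nat \<Rightarrow> 'v"
  shows "of_nat (p ^ Suc n) dvd ghost p (\<lambda>i. poly_var (f i)) (Suc n) -
    poly_eval (\<lambda>v. poly_var v ^ p) (ghost p (\<lambda>i. poly_var (f i)) n)"
proof -
  have "poly_eval (\<lambda>v. poly_var v ^ p) (ghost p (\<lambda>i. poly_var (f i)) n) =
      (\<Sum>i<Suc n. of_nat (p ^ i) * poly_var (f i) ^ (p ^ (Suc n - i)))"
    unfolding poly_eval_ghost unfolding ghost_def lessThan_Suc_atMost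
    by (intro sum.cong) (auto simp: Suc_diff_le simp flip: power_mult power_Suc)
  then show ?thesis
    by (simp only: ghost_eq[of p _ "Suc n"]) simp
qed

text \<open>Justifies the definite description in \<open>witt_add_poly\<close>: Dwork's lemma gives
  existence, \<open>ghost_inject\<close> uniqueness.\<close>

lemma ghost_witt_add_poly:
  assumes "prime p"
  shows "ghost p (witt_add_poly p) n =
    ghost p (\<lambda>i. poly_var (Inl i)) n + ghost p (\<lambda>i. poly_var (Inr i)) n"
proof -
  have "of_nat (p ^ Suc n) dvd
      (ghost p (\<lambda>i. poly_var (Inl i)) (Suc n) + ghost p (\<lambda>i. poly_var (Inr i)) (Suc n)) -
      poly_eval (\<lambda>v. poly_var v ^ p)
        (ghost p (\<lambda>i. poly_var (Inl i)) n + ghost p (\<lambda>i. poly_var (Inr i)) n)" for n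
    using dvd_add[OF ghost_vars_Suc[of p n "Inl :: nat \<Rightarrow> nat + nat"]
        ghost_vars_Suc[of p n "Inr :: nat \<Rightarrow> nat + nat"]]
    by (simp add: poly_eval_add algebra_simps)
  then have "\<exists>!S. \<forall>n. ghost p S n =
      ghost p (\<lambda>i. xy_var (Inl i)) n + ghost p (\<lambda>i. xy_var (Inr i)) n"
    unfolding xy_var_eq_poly_var
    using ghost_eqs_solvable[OF assms, of "\<lambda>n. ghost p (\<lambda>i. poly_var (Inl i)) n +
        ghost p (\<lambda>i. poly_var (Inr i)) n"] ghost_inject[of p] assms
    by (metis not_prime_0)
  from theI'[OF this] show ?thesis
    by (simp add: witt_add_poly_def xy_var_eq_poly_var)
qed

lemma ghost_witt_mult_poly:
  assumes "prime p"
  shows "ghost p (witt_mult_poly p) n =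
    ghost p (\<lambda>i. poly_var (Inl i)) n * ghost p (\<lambda>i. poly_var (Inr i)) n"
proof -
  have "of_nat (p ^ Suc n) dvd
      (ghost p (\<lambda>i. poly_var (Inl i)) (Suc n) * ghost p (\<lambda>i. poly_var (Inr i)) (Suc n)) -
      poly_eval (\<lambda>v. poly_var v ^ p)
        (ghost p (\<lambda>i. poly_var (Inl i)) n * ghost p (\<lambda>i. poly_var (Inr i)) n)" for n
  proof -
    have mult_diff: "d dvd a * b - a' * b'" if "d dvd a - a'" "d dvd b - b'"
      for a a' b b' d :: xy_poly
    proof -
      have "a * b - a' * b' = (a - a') * b + a' * (b - b')"
        by (simp add: algebra_simps)
      then show ?thesis
        using that by simp
    qed
    show ?thesis
      unfolding poly_eval_mult by (intro mult_diff ghost_vars_Suc)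
  qed
  then have "\<exists>!S. \<forall>n. ghost p S n =
      ghost p (\<lambda>i. xy_var (Inl i)) n * ghost p (\<lambda>i. xy_var (Inr i)) n"
    unfolding xy_var_eq_poly_var
    using ghost_eqs_solvable[OF assms, of "\<lambda>n. ghost p (\<lambda>i. poly_var (Inl i)) n *
        ghost p (\<lambda>i. poly_var (Inr i)) n"] ghost_inject[of p] assms
    by (metis not_prime_0)
  from theI'[OF this] show ?thesis
    by (simp add: witt_mult_poly_def xy_var_eq_poly_var)
qed


section \<open>The multiplicative monoid of Witt vectors\<close>

abbreviation wmult :: "nat \<Rightarrow> (nat \<Rightarrow> 'a::comm_ring_1) \<Rightarrow> (nat \<Rightarrow> 'a) \<Rightarrow> nat \<Rightarrow> 'a" where
  "wmult p x y \<equiv> x \<otimes>\<^bsub>witt_ring p\<^esub> y"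

abbreviation wadd :: "nat \<Rightarrow> (nat \<Rightarrow> 'a::comm_ring_1) \<Rightarrow> (nat \<Rightarrow> 'a) \<Rightarrow> nat \<Rightarrow> 'a" where
  "wadd p x y \<equiv> x \<oplus>\<^bsub>witt_ring p\<^esub> y"

abbreviation wone :: "nat \<Rightarrow> 'a::comm_ring_1" where
  "wone \<equiv> (\<lambda>n. if n = 0 then 1 else 0)"

lemma wmult_eq: "wmult p x y n = poly_eval (case_sum x y) (witt_mult_poly p n)"
  by (simp add: witt_ring_def xy_eval_eq_poly_eval)

lemma wadd_eq: "wadd p x y n = poly_eval (case_sum x y) (witt_add_poly p n)"
  by (simp add: witt_ring_def xy_eval_eq_poly_eval)

lemma one_witt_ring: "\<one>\<^bsub>witt_ring p\<^esub> = wone"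
  by (simp add: witt_ring_def)

lemma carrier_witt_ring [simp]: "carrier (witt_ring p) = UNIV"
  by (simp add: witt_ring_def)

text \<open>Valid over every commutative ring, being the evaluation of a polynomial
  identity.\<close>

lemma ghost_wmult:
  assumes "prime p"
  shows "ghost p (wmult p x y) n = ghost p x n * ghost p y n"
  using arg_cong[OF ghost_witt_mult_poly[OF assms, of n], of "poly_eval (case_sum x y)"]
  by (simp add: poly_eval_ghost poly_eval_mult flip: wmult_eq)

lemma ghost_wadd:
  assumes "prime p"
  shows "ghost p (wadd p x y) n = ghost p x n + ghost p y n"
  using arg_cong[OF ghost_witt_add_poly[OF assms, of n], of "poly_eval (case_sum x y)"]
  by (simp add: poly_eval_ghost poly_eval_add flip: wadd_eq)

lemma ghost_teichmueller:
  assumes "p \<noteq> 0"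
  shows "ghost p (teichmueller a) n = a ^ (p ^ n)"
proof -
  have "ghost p (teichmueller a) n = (\<Sum>i\<in>{0}. of_nat (p ^ i) * teichmueller a i ^ (p ^ (n - i)))"
    unfolding ghost_def
    by (rule sum.mono_neutral_right) (use assms in \<open>auto simp: teichmueller_def power_0_left\<close>)
  then show ?thesis
    by (simp add: teichmueller_def)
qed

lemma wone_eq_teichmueller: "wone = teichmueller 1"
  by (simp add: teichmueller_def)

lemma poly_eval_wmult:
  "poly_eval s (wmult p x y n) = wmult p (\<lambda>i. poly_eval s (x i)) (\<lambda>i. poly_eval s (y i)) n"
  by (simp add: wmult_eq poly_eval_poly_eval) (auto intro!: arg_cong2[of _ _ _ _ poly_eval] split: sum.split)

lemma poly_eval_wadd:
  "poly_eval s (wadd p x y n) = wadd p (\<lambda>i. poly_eval s (x i)) (\<lambda>i. poly_eval s (y i)) n"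
  by (simp add: wadd_eq poly_eval_poly_eval) (auto intro!: arg_cong2[of _ _ _ _ poly_eval] split: sum.split)

text \<open>
  Every ring \<open>A\<close> is the image of the torsion-free ring \<open>\<int>[A]\<close>, where Witt vectors are determined
  by their ghost components. So it suffices to check identities on \<open>\<int>[A]\<close>.
\<close>

definition witt_lift :: "(nat \<Rightarrow> 'a) \<Rightarrow> nat \<Rightarrow> ('a \<Rightarrow>\<^sub>0 nat) \<Rightarrow>\<^sub>0 int" where
  "witt_lift x = (\<lambda>i. poly_var (x i))"

definition witt_proj :: "(nat \<Rightarrow> ('a::comm_ring_1 \<Rightarrow>\<^sub>0 nat) \<Rightarrow>\<^sub>0 int) \<Rightarrow> nat \<Rightarrow> 'a" where
  "witt_proj x = (\<lambda>i. poly_eval (\<lambda>a. a) (x i))"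

lemma witt_proj_lift [simp]: "witt_proj (witt_lift x) = x"
  by (simp add: witt_proj_def witt_lift_def)

lemma witt_proj_wmult [simp]: "witt_proj (wmult p x y) = wmult p (witt_proj x) (witt_proj y)"
  by (simp add: witt_proj_def poly_eval_wmult)

lemma witt_proj_wadd [simp]: "witt_proj (wadd p x y) = wadd p (witt_proj x) (witt_proj y)"
  by (simp add: witt_proj_def poly_eval_wadd)

lemma witt_proj_teichmueller [simp]:
  "witt_proj (teichmueller a) = teichmueller (poly_eval (\<lambda>a. a) a)"
  by (auto simp: witt_proj_def teichmueller_def)

section \<open>Monoid laws and the Teichmueller lift\<close>

lemma wmult_assoc:
  assumes "prime p"
  shows "wmult p (wmult p x y) z = wmult p x (wmult p y z)"
proof -
  have "wmult p (wmult p (witt_lift x) (witt_lift y)) (witt_lift z) =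
      wmult p (witt_lift x) (wmult p (witt_lift y) (witt_lift z))"
    by (rule ghost_inject[of p]) (use assms in \<open>auto simp: ghost_wmult mult.assoc\<close>)
  from arg_cong[OF this, of witt_proj] show ?thesis
    by simp
qed

lemma wmult_commute:
  assumes "prime p"
  shows "wmult p x y = wmult p y x"
proof -
  have "wmult p (witt_lift x) (witt_lift y) = wmult p (witt_lift y) (witt_lift x)"
    by (rule ghost_inject[of p]) (use assms in \<open>auto simp: ghost_wmult mult.commute\<close>)
  from arg_cong[OF this, of witt_proj] show ?thesis
    by simp
qed

lemma wmult_one:
  assumes "prime p"
  shows "wmult p wone x = x"
proof -
  have "p \<noteq> 0"
    using assms by auto
  then have "wmult p (teichmueller 1) (witt_lift x) = witt_lift x"
    by (intro ghost_inject[of p]) (use assms in \<open>auto simp: ghost_wmult ghost_teichmueller\<close>)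
  from arg_cong[OF this, of witt_proj] show ?thesis
    by (simp add: wone_eq_teichmueller)
qed

lemma wmult_teichmueller:
  assumes "prime p"
  shows "wmult p (teichmueller a) (teichmueller b) = teichmueller (a * b)"
proof -
  have "p \<noteq> 0"
    using assms by auto
  then have "wmult p (teichmueller (poly_var a)) (teichmueller (poly_var b)) =
      teichmueller (poly_var a * poly_var b)"
    by (intro ghost_inject[of p])
      (use assms in \<open>auto simp: ghost_wmult ghost_teichmueller power_mult_distrib\<close>)
  from arg_cong[OF this, of witt_proj] show ?thesis
    by (simp add: poly_eval_mult)
qed

lemma wadd_zero:
  fixes x :: "nat \<Rightarrow> 'a::comm_ring_1"
  assumes "prime p"
  shows "wadd p x (\<lambda>_. 0) = x"
proof -
  have "p \<noteq> 0"
    using assms by auto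
  then have "wadd p (witt_lift x) (teichmueller 0) = witt_lift x"
    by (intro ghost_inject[of p]) (use assms in \<open>auto simp: ghost_wadd ghost_teichmueller power_0_left\<close>)
  from arg_cong[OF this, of witt_proj] have "wadd p x (teichmueller 0) = x"
    by simp
  moreover have "teichmueller 0 = (\<lambda>_. 0 :: 'a)"
    by (auto simp: teichmueller_def)
  ultimately show ?thesis
    by simp
qed

section \<open>Dependence of sums and products on a single component\<close>

lemma ghost_cong:
  assumes "\<And>i. i \<le> n \<Longrightarrow> x i = y i"
  shows "ghost p x n = ghost p y n"
  unfolding ghost_def using assms by (intro sum.cong) auto

text \<open>Over the torsion-free ring, \<open>Y n\<close> enters ghost component \<open>n\<close>
  of the product only through \<open>ghost p X n * p ^ n * Y n\<close>; cancelling
  \<open>p ^ n\<close> gives the formula. It makes equations for a product linear in the last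
  unknown component.\<close>

lemma wmult_diff:
  assumes "prime p" and y: "\<And>m. m < n \<Longrightarrow> y m = y' m"
  shows "wmult p x y n - wmult p x y' n = ghost p x n * (y n - y' n)"
proof -
  define X Y Y' where "X = witt_lift x" and "Y = witt_lift y" and "Y' = witt_lift y'"
  have p: "p \<noteq> 0"
    using assms by auto
  have Y: "Y m = Y' m" if "m < n" for m
    using y[OF that] by (simp add: Y_def Y'_def witt_lift_def)
  have below: "wmult p X Y m = wmult p X Y' m" if "m < n" for m
  proof (rule ghost_inject_below[OF p _ that])
    fix m assume "m < n"
    then have "ghost p Y m = ghost p Y' m"
      by (intro ghost_cong Y) auto
    then show "ghost p (wmult p X Y) m = ghost p (wmult p X Y') m"
      using assms(1) by (simp add: ghost_wmult)
  qed
  have "ghost p (wmult p X Y) n - ghost p (wmult p X Y') n = ghost p X n * (ghost p Y n - ghost p Y' n)"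
    using assms(1) by (simp add: ghost_wmult algebra_simps)
  moreover have "ghost p (wmult p X Y) n - ghost p (wmult p X Y') n =
      of_nat (p ^ n) * (wmult p X Y n - wmult p X Y' n)"
    by (simp add: ghost_eq below algebra_simps)
  moreover have "ghost p Y n - ghost p Y' n = of_nat (p ^ n) * (Y n - Y' n)"
    by (simp add: ghost_eq Y algebra_simps)
  ultimately have "of_nat (p ^ n) * (wmult p X Y n - wmult p X Y' n) =
      of_nat (p ^ n) * (ghost p X n * (Y n - Y' n))"
    by (simp add: algebra_simps)
  then have "wmult p X Y n - wmult p X Y' n = ghost p X n * (Y n - Y' n)"
    by (rule poly_of_nat_mult_left_cancel) (use p in simp)
  from arg_cong[OF this, of "poly_eval (\<lambda>a. a)"] show ?thesis
    by (simp add: poly_eval_diff poly_eval_mult poly_eval_ghost poly_eval_wmult X_def Y_def Y'_def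
        witt_lift_def)
qed

lemma wadd_diff:
  assumes "prime p" and y: "\<And>m. m < n \<Longrightarrow> y m = y' m"
  shows "wadd p x y n - wadd p x y' n = y n - y' n"
proof -
  define X Y Y' where "X = witt_lift x" and "Y = witt_lift y" and "Y' = witt_lift y'"
  have p: "p \<noteq> 0"
    using assms by auto
  have Y: "Y m = Y' m" if "m < n" for m
    using y[OF that] by (simp add: Y_def Y'_def witt_lift_def)
  have below: "wadd p X Y m = wadd p X Y' m" if "m < n" for m
  proof (rule ghost_inject_below[OF p _ that])
    fix m assume "m < n"
    then have "ghost p Y m = ghost p Y' m"
      by (intro ghost_cong Y) auto
    then show "ghost p (wadd p X Y) m = ghost p (wadd p X Y') m"
      using assms(1) by (simp add: ghost_wadd)
  qed
  have "ghost p (wadd p X Y) n - ghost p (wadd p X Y') n = ghost p Y n - ghost p Y' n"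
    using assms(1) by (simp add: ghost_wadd algebra_simps)
  moreover have "ghost p (wadd p X Y) n - ghost p (wadd p X Y') n =
      of_nat (p ^ n) * (wadd p X Y n - wadd p X Y' n)"
    by (simp add: ghost_eq below algebra_simps)
  moreover have "ghost p Y n - ghost p Y' n = of_nat (p ^ n) * (Y n - Y' n)"
    by (simp add: ghost_eq Y algebra_simps)
  ultimately have "of_nat (p ^ n) * (wadd p X Y n - wadd p X Y' n) = of_nat (p ^ n) * (Y n - Y' n)"
    by simp
  then have "wadd p X Y n - wadd p X Y' n = Y n - Y' n"
    by (rule poly_of_nat_mult_left_cancel) (use p in simp)
  from arg_cong[OF this, of "poly_eval (\<lambda>a. a)"] show ?thesis
    by (simp add: poly_eval_diff poly_eval_wadd X_def Y_def Y'_def witt_lift_def)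
qed

lemma wmult_cong_below:
  assumes "prime p" "\<And>i. i \<le> n \<Longrightarrow> y i = y' i"
  shows "wmult p x y n = wmult p x y' n"
  using wmult_diff[of p n y y' x] assms by simp

lemma comm_monoid_witt_ring:
  assumes "prime p"
  shows "comm_monoid (witt_ring p :: (nat \<Rightarrow> 'a::comm_ring_1) ring)"
  by (rule comm_monoidI)
    (auto simp: one_witt_ring wmult_one[OF assms]
      intro: wmult_assoc[OF assms] wmult_commute[OF assms])

lemma teichmueller_nat_pow:
  fixes a :: "'a::comm_ring_1" and n :: nat
  assumes "prime p"
  shows "teichmueller a [^]\<^bsub>witt_ring p\<^esub> n = teichmueller (a ^ n)"
proof -
  interpret comm_monoid "witt_ring p :: (nat \<Rightarrow> 'a) ring"
    by (rule comm_monoid_witt_ring) fact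
  show ?thesis
    by (induction n)
      (simp_all add: one_witt_ring wone_eq_teichmueller wmult_teichmueller[OF assms] mult.commute)
qed

lemma finprod_teichmueller:
  fixes f :: "'i \<Rightarrow> 'a::comm_ring_1"
  assumes "prime p"
  shows "finprod (witt_ring p) (\<lambda>i. teichmueller (f i)) F = teichmueller (\<Prod>i\<in>F. f i)"
proof -
  interpret comm_monoid "witt_ring p :: (nat \<Rightarrow> 'a) ring"
    by (rule comm_monoid_witt_ring) fact
  show ?thesis
    by (induction F rule: infinite_finite_induct)
      (simp_all add: one_witt_ring wone_eq_teichmueller wmult_teichmueller[OF assms])
qed

lemma wmult_0:
  assumes "prime p"
  shows "wmult p x y 0 = x 0 * y 0"
  using ghost_wmult[OF assms, of x y 0] by (simp add: ghost_def)


section \<open>Witt vectors over a field of characteristic \<open>p\<close>\<close>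

lemma ghost_char_p:
  assumes "of_nat p = (0 :: 'a::comm_ring_1)"
  shows "ghost p x n = (x 0 :: 'a) ^ (p ^ n)"
proof -
  have "ghost p x n = (\<Sum>i\<in>{0}. of_nat (p ^ i) * x i ^ (p ^ (n - i)))"
    unfolding ghost_def
    by (rule sum.mono_neutral_right) (use assms in \<open>auto simp: power_0_left\<close>)
  then show ?thesis
    by simp
qed

text \<open>An inverse is found component by component. In characteristic \<open>p\<close> the
  unknown \<open>y n\<close> has the coefficient \<open>x 0 ^ (p ^ n)\<close>, which is
  invertible.\<close>

lemma Units_witt_ring_iff:
  fixes x :: "nat \<Rightarrow> 'a::field"
  assumes p: "prime p" and char: "of_nat p = (0 :: 'a)"
  shows "x \<in> Units (witt_ring p) \<longleftrightarrow> x 0 \<noteq> 0"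
proof
  assume "x \<in> Units (witt_ring p)"
  then obtain y where "wmult p y x = wone"
    by (auto simp: Units_def one_witt_ring)
  from fun_cong[OF this, of 0] show "x 0 \<noteq> 0"
    by (auto simp: wmult_0[OF p])
next
  assume x: "x 0 \<noteq> 0"
  \<comment> \<open>Cutting \<open>y\<close> off at index \<open>n\<close> isolates the contribution
    of \<open>y n\<close>, as \<open>wmult_diff\<close> shows, and leaves a recursion on earlier
    values only.\<close>
  have "\<exists>y. \<forall>n. wmult p x (\<lambda>i. if i < n then y i else 0) n + x 0 ^ (p ^ n) * y n = wone n"
  proof (rule dependent_wellorder_choice)
    fix r :: 'a and f g :: "nat \<Rightarrow> 'a" and n :: nat
    assume "\<And>y. y < n \<Longrightarrow> f y = g y"
    then have "(\<lambda>i. if i < n then f i else 0) = (\<lambda>i. if i < n then g i else 0)"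
      by auto
    then show "(wmult p x (\<lambda>i. if i < n then f i else 0) n + x 0 ^ (p ^ n) * r = wone n) =
        (wmult p x (\<lambda>i. if i < n then g i else 0) n + x 0 ^ (p ^ n) * r = wone n)"
      by simp
  next
    fix n :: nat and f :: "nat \<Rightarrow> 'a"
    show "\<exists>r. wmult p x (\<lambda>i. if i < n then f i else 0) n + x 0 ^ (p ^ n) * r = wone n"
      using x
      by (intro exI[of _ "(wone n - wmult p x (\<lambda>i. if i < n then f i else 0) n) / x 0 ^ (p ^ n)"]) simp
  qed
  then obtain y where y: "\<And>n. wmult p x (\<lambda>i. if i < n then y i else 0) n + x 0 ^ (p ^ n) * y n = wone n"
    by blast
  have "wmult p x y = wone"
  proof
    fix n
    show "wmult p x y n = wone n"
      using wmult_diff[OF p, of n y "\<lambda>i. if i < n then y i else 0" x] y[of n]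
      by (simp add: ghost_char_p[OF char] algebra_simps split: if_splits)
  qed
  then show "x \<in> Units (witt_ring p)"
    using wmult_commute[OF p, of x y] by (auto simp: Units_def one_witt_ring)
qed

text \<open>The subgroup \<open>1 + V\<^sup>n W\<close> of the unit group.\<close>

definition one_below :: "nat \<Rightarrow> (nat \<Rightarrow> 'a::comm_ring_1) \<Rightarrow> bool" where
  "one_below n x \<longleftrightarrow> (\<forall>i<n. x i = wone i)"

lemma wmult_one_below_left:
  assumes "prime p" "one_below (Suc n) y"
  shows "wmult p x y n = x n"
proof -
  have "wmult p x y n = wmult p x wone n"
    by (rule wmult_cong_below[OF assms(1)]) (use assms(2) in \<open>auto simp: one_below_def\<close>)
  also have "\<dots> = x n"
    by (simp only: wmult_commute[OF assms(1), of x] wmult_one[OF assms(1)])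
  finally show ?thesis .
qed

lemma one_below_mono: "one_below n x \<Longrightarrow> m \<le> n \<Longrightarrow> one_below m x"
  by (auto simp: one_below_def)

lemma one_below_wmult:
  assumes "prime p" "one_below n x" "one_below n y"
  shows "one_below n (wmult p x y)"
  unfolding one_below_def
proof (intro allI impI)
  fix i assume "i < n"
  then have "wmult p x y i = x i"
    using assms one_below_mono[of n y "Suc i"] by (intro wmult_one_below_left) auto
  also have "\<dots> = wone i"
    using assms(2) \<open>i < n\<close> by (simp add: one_below_def)
  finally show "wmult p x y i = wone i" .
qed

text \<open>Compare \<open>y\<close> with \<open>wone\<close> in \<open>wmult_diff\<close>: the
  coefficient is a power of \<open>x 0\<close>, which is 1 because \<open>0 < n\<close>, and
  \<open>wone n\<close> is 0.\<close>

lemma wmult_one_below_nth: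
  fixes x y :: "nat \<Rightarrow> 'a::comm_ring_1"
  assumes p: "prime p" and char: "of_nat p = (0 :: 'a)"
    and n: "0 < n" and "one_below n x" "one_below n y"
  shows "wmult p x y n = x n + y n"
proof -
  have "wmult p x y n - wmult p x wone n = x 0 ^ (p ^ n) * (y n - wone n)"
    using wmult_diff[OF p, of n y wone x] assms by (simp add: ghost_char_p one_below_def)
  moreover have "wmult p x wone n = x n"
    by (simp only: wmult_commute[OF p, of x] wmult_one[OF p])
  ultimately show ?thesis
    using assms by (simp add: one_below_def algebra_simps)
qed

lemma one_below_finprod:
  fixes f :: "'i \<Rightarrow> nat \<Rightarrow> 'a::comm_ring_1"
  assumes p: "prime p" and "\<And>i. i \<in> F \<Longrightarrow> one_below n (f i)"
  shows "one_below n (finprod (witt_ring p) f F)"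
proof -
  interpret comm_monoid "witt_ring p :: (nat \<Rightarrow> 'a) ring"
    by (rule comm_monoid_witt_ring) fact
  show ?thesis
    using assms(2)
    by (induction F rule: infinite_finite_induct)
      (auto intro!: one_below_wmult[OF p] simp: one_witt_ring one_below_def[of _ wone])
qed

lemma finprod_one_below_nth:
  fixes f :: "'i \<Rightarrow> nat \<Rightarrow> 'a::comm_ring_1"
  assumes p: "prime p" and char: "of_nat p = (0 :: 'a)" and "0 < n"
    and "\<And>i. i \<in> F \<Longrightarrow> one_below n (f i)"
  shows "finprod (witt_ring p) f F n = (\<Sum>i\<in>F. f i n)"
proof -
  interpret comm_monoid "witt_ring p :: (nat \<Rightarrow> 'a) ring"
    by (rule comm_monoid_witt_ring) fact
  show ?thesis
    using assms(4)
    by (induction F rule: infinite_finite_induct)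
      (auto simp: wmult_one_below_nth[OF p char \<open>0 < n\<close>] one_below_finprod[OF p]
        one_witt_ring \<open>0 < n\<close>)
qed

lemma one_below_nat_pow:
  fixes x :: "nat \<Rightarrow> 'a::comm_ring_1" and k :: nat
  assumes p: "prime p" and "one_below n x"
  shows "one_below n (x [^]\<^bsub>witt_ring p\<^esub> k)"
proof -
  interpret comm_monoid "witt_ring p :: (nat \<Rightarrow> 'a) ring"
    by (rule comm_monoid_witt_ring) fact
  show ?thesis
    by (induction k)
      (auto intro!: one_below_wmult[OF p] assms simp: one_witt_ring one_below_def[of _ wone])
qed

lemma nat_pow_one_below_nth:
  fixes x :: "nat \<Rightarrow> 'a::comm_ring_1" and k :: nat
  assumes p: "prime p" and char: "of_nat p = (0 :: 'a)" and "0 < n" and "one_below n x"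
  shows "(x [^]\<^bsub>witt_ring p\<^esub> k) n = of_nat k * x n"
proof -
  interpret comm_monoid "witt_ring p :: (nat \<Rightarrow> 'a) ring"
    by (rule comm_monoid_witt_ring) fact
  show ?thesis
    by (induction k)
      (auto simp: wmult_one_below_nth[OF p char \<open>0 < n\<close>] one_below_nat_pow[OF p] assms
        one_witt_ring \<open>0 < n\<close> algebra_simps)
qed


section \<open>The \<open>T\<close>-adic topology\<close>

text \<open>Congruence modulo \<open>T^N k[[T]]\<close>, for \<open>N\<close> of either sign and
  series with arbitrary poles.\<close>

definition fls_cong :: "int \<Rightarrow> 'a::field fls \<Rightarrow> 'a fls \<Rightarrow> bool" where
  "fls_cong N f g \<longleftrightarrow> (\<forall>k<N. f $$ k = g $$ k)"

lemma fls_cong_refl [simp]: "fls_cong N f f"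
  by (simp add: fls_cong_def)

lemma fls_cong_sym: "fls_cong N f g \<Longrightarrow> fls_cong N g f"
  by (simp add: fls_cong_def)

lemma fls_cong_trans: "fls_cong N f g \<Longrightarrow> fls_cong N g h \<Longrightarrow> fls_cong N f h"
  by (simp add: fls_cong_def)

lemma fls_cong_mono: "fls_cong N f g \<Longrightarrow> M \<le> N \<Longrightarrow> fls_cong M f g"
  by (simp add: fls_cong_def)

lemma fls_cong_add: "fls_cong N f f' \<Longrightarrow> fls_cong N g g' \<Longrightarrow> fls_cong N (f + g) (f' + g')"
  by (simp add: fls_cong_def)

lemma fls_cong_iff_diff: "fls_cong N f g \<longleftrightarrow> fls_cong N (f - g) 0"
  by (simp add: fls_cong_def)

lemma fls_cong_0_iff: "fls_cong N f 0 \<longleftrightarrow> f = 0 \<or> N \<le> fls_subdegree f"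
  by (auto simp: fls_cong_def intro: fls_subdegree_geI fls_eq0_below_subdegree)

lemma fls_cong_0_mult:
  "fls_cong M f 0 \<Longrightarrow> fls_cong N g 0 \<Longrightarrow> fls_cong (M + N) (f * g) 0"
  by (cases "f = 0 \<or> g = 0") (auto simp: fls_cong_0_iff)

lemma fls_eqI_cong:
  assumes "\<And>N :: nat. fls_cong (int N) f g"
  shows "f = g"
proof (rule fls_eqI)
  fix k
  show "f $$ k = g $$ k"
    using assms[of "nat (k + 1)"] by (simp add: fls_cong_def)
qed

text \<open>The distance is 2 to the minus subdegree of the difference, so small balls are
  congruence classes. Natural \<open>N\<close> suffice, since higher congruences imply lower
  ones.\<close>

lemma tendsto_fls_iff:
  fixes f :: "'b \<Rightarrow> 'a::field fls"
  shows "(f \<longlongrightarrow> l) F \<longleftrightarrow> (\<forall>N::nat. eventually (\<lambda>x. fls_cong (int N) (f x) l) F)"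
proof
  assume f: "(f \<longlongrightarrow> l) F"
  show "\<forall>N::nat. eventually (\<lambda>x. fls_cong (int N) (f x) l) F"
  proof
    fix N :: nat
    have "eventually (\<lambda>x. dist (f x) l < inverse (2 ^ N)) F"
      using f by (simp add: tendsto_iff)
    then show "eventually (\<lambda>x. fls_cong (int N) (f x) l) F"
    proof eventually_elim
      case (elim x)
      have "int N \<le> fls_subdegree (f x - l)" if "f x \<noteq> l"
      proof (cases "fls_subdegree (f x - l) \<ge> 0")
        case True
        then have "(2::real) ^ N < 2 ^ nat (fls_subdegree (f x - l))"
          using elim that by (simp add: dist_fls_def)
        then show ?thesis
          by simp
      next
        case False
        have "inverse (2 ^ N) \<le> (1::real)" "1 \<le> (2::real) ^ nat (- fls_subdegree (f x - l))"
          by (simp_all add: inverse_le_1_iff)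
        moreover have "dist (f x) l = 2 ^ nat (- fls_subdegree (f x - l))"
          using that False by (simp add: dist_fls_def)
        ultimately show ?thesis
          using elim by linarith
      qed
      then show ?case
        by (subst fls_cong_iff_diff) (auto simp: fls_cong_0_iff)
    qed
  qed
next
  assume f: "\<forall>N::nat. eventually (\<lambda>x. fls_cong (int N) (f x) l) F"
  show "(f \<longlongrightarrow> l) F"
    unfolding tendsto_iff
  proof (intro allI impI)
    fix e :: real assume "0 < e"
    then obtain N where N: "inverse (2 ^ N) < e"
      using real_arch_pow_inv[of e "1/2"] by (auto simp: field_simps)
    from f have "eventually (\<lambda>x. fls_cong (int N) (f x) l) F"
      by blast
    then show "eventually (\<lambda>x. dist (f x) l < e) F"
    proof eventually_elim
      case (elim x)
      have "dist (f x) l \<le> inverse (2 ^ N)"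
      proof (cases "f x = l")
        case False
        then have "int N \<le> fls_subdegree (f x - l)"
          using elim by (subst (asm) fls_cong_iff_diff) (auto simp: fls_cong_0_iff)
        then show ?thesis
          using False by (simp add: dist_fls_def)
      qed simp
      with N show ?case
        by simp
    qed
  qed
qed

lemma tendsto_fls_add:
  fixes f g :: "'b \<Rightarrow> 'a::field fls"
  assumes "(f \<longlongrightarrow> a) F" "(g \<longlongrightarrow> b) F"
  shows "((\<lambda>x. f x + g x) \<longlongrightarrow> a + b) F"
  unfolding tendsto_fls_iff
proof
  fix N :: nat
  have "eventually (\<lambda>x. fls_cong (int N) (f x) a) F" "eventually (\<lambda>x. fls_cong (int N) (g x) b) F"
    using assms by (simp_all add: tendsto_fls_iff)
  then show "eventually (\<lambda>x. fls_cong (int N) (f x + g x) (a + b)) F"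
    by eventually_elim (rule fls_cong_add)
qed

lemma tendsto_fls_mult:
  fixes f g :: "'b \<Rightarrow> 'a::field fls"
  assumes "(f \<longlongrightarrow> a) F" "(g \<longlongrightarrow> b) F"
  shows "((\<lambda>x. f x * g x) \<longlongrightarrow> a * b) F"
  unfolding tendsto_fls_iff
proof
  fix N :: nat
  \<comment> \<open>The extra precision absorbs possible poles of \<open>a\<close> and
    \<open>b\<close> in the mixed terms \<open>a * (g x - b)\<close> and
    \<open>(f x - a) * b\<close>.\<close>
  define M where "M = N + nat \<bar>fls_subdegree a\<bar> + nat \<bar>fls_subdegree b\<bar>"
  have "eventually (\<lambda>x. fls_cong (int M) (f x) a) F" "eventually (\<lambda>x. fls_cong (int M) (g x) b) F"
    using assms by (simp_all add: tendsto_fls_iff)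
  then show "eventually (\<lambda>x. fls_cong (int N) (f x * g x) (a * b)) F"
  proof eventually_elim
    case (elim x)
    have fa: "fls_cong (int M) (f x - a) 0" and gb: "fls_cong (int M) (g x - b) 0"
      using elim by (simp_all flip: fls_cong_iff_diff)
    have a: "fls_cong (fls_subdegree a) a 0" and b: "fls_cong (fls_subdegree b) b 0"
      by (simp_all add: fls_cong_0_iff)
    have "fls_cong (int N) ((f x - a) * (g x - b)) 0"
      by (rule fls_cong_mono[OF fls_cong_0_mult[OF fa gb]]) (simp add: M_def)
    moreover have "fls_cong (int N) (a * (g x - b)) 0"
      by (rule fls_cong_mono[OF fls_cong_0_mult[OF a gb]]) (simp add: M_def)
    moreover have "fls_cong (int N) ((f x - a) * b) 0"
      by (rule fls_cong_mono[OF fls_cong_0_mult[OF fa b]]) (simp add: M_def)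
    moreover have "f x * g x - a * b = (f x - a) * (g x - b) + a * (g x - b) + (f x - a) * b"
      by (simp add: algebra_simps)
    ultimately show ?case
      by (subst fls_cong_iff_diff) (simp add: fls_cong_def)
  qed
qed

text \<open>Registered as class instances so that \<open>tendsto_intros\<close> covers the finite
  sums and products in \<open>poly_eval\<close>.\<close>

instance fls :: (field) topological_comm_monoid_add
proof
  fix a b :: "'a fls"
  show "LIM x (nhds a \<times>\<^sub>F nhds b). fst x + snd x :> nhds (a + b)"
    by (rule tendsto_fls_add)
      (simp_all add: filterlim_def filtermap_fst_prod_filter filtermap_snd_prod_filter)
qed

instance fls :: (field) topological_comm_monoid_mult
proof
  fix a b :: "'a fls"
  show "LIM x (nhds a \<times>\<^sub>F nhds b). fst x * snd x :> nhds (a * b)"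
    by (rule tendsto_fls_mult)
      (simp_all add: filterlim_def filtermap_fst_prod_filter filtermap_snd_prod_filter)
qed

lemma tendsto_poly_eval:
  fixes s :: "'b \<Rightarrow> 'v \<Rightarrow> 'a::field fls"
  assumes "\<And>v. ((\<lambda>x. s x v) \<longlongrightarrow> t v) F"
  shows "((\<lambda>x. poly_eval (s x) P) \<longlongrightarrow> poly_eval t P) F"
  unfolding poly_eval_def mono_eval_def by (intro tendsto_intros assms)

lemma tendsto_wmult:
  fixes x y :: "'b \<Rightarrow> nat \<Rightarrow> 'a::field fls"
  assumes "\<And>n. ((\<lambda>i. x i n) \<longlongrightarrow> a n) F" "\<And>n. ((\<lambda>i. y i n) \<longlongrightarrow> b n) F"
  shows "((\<lambda>i. wmult p (x i) (y i) n) \<longlongrightarrow> wmult p a b n) F"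
  unfolding wmult_eq
  by (rule tendsto_poly_eval) (use assms in \<open>auto split: sum.split\<close>)


section \<open>Congruences between integral Witt vectors\<close>

text \<open>Integrality of both sides is built in because a bare congruence modulo
  \<open>T^N\<close> does not survive multiplication by a series with a pole. Hence
  \<open>fls_icong N f f\<close> is not automatic.\<close>

definition fls_icong :: "int \<Rightarrow> 'a::field fls \<Rightarrow> 'a fls \<Rightarrow> bool" where
  "fls_icong N f g \<longleftrightarrow> fls_cong 0 f 0 \<and> fls_cong 0 g 0 \<and> fls_cong N f g"

lemma fls_icong_sym: "fls_icong N f g \<Longrightarrow> fls_icong N g f"
  by (auto simp: fls_icong_def intro: fls_cong_sym)

lemma fls_icong_trans: "fls_icong N f g \<Longrightarrow> fls_icong N g h \<Longrightarrow> fls_icong N f h"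
  by (auto simp: fls_icong_def intro: fls_cong_trans)

lemma fls_icong_mono: "fls_icong N f g \<Longrightarrow> M \<le> N \<Longrightarrow> fls_icong M f g"
  by (auto simp: fls_icong_def intro: fls_cong_mono)

lemma fls_icong_add: "fls_icong N f f' \<Longrightarrow> fls_icong N g g' \<Longrightarrow> fls_icong N (f + g) (f' + g')"
  by (auto simp: fls_icong_def fls_cong_def)

lemma fls_icong_mult:
  assumes "fls_icong N f f'" "fls_icong N g g'"
  shows "fls_icong N (f * g) (f' * g')"
proof -
  have "fls_cong (N + 0) ((f - f') * g) 0" "fls_cong (0 + N) (f' * (g - g')) 0"
    using assms fls_cong_iff_diff[of N f f'] fls_cong_iff_diff[of N g g']
    by (auto simp only: fls_icong_def intro!: fls_cong_0_mult)
  moreover have "f * g - f' * g' = (f - f') * g + f' * (g - g')"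
    by (simp add: algebra_simps)
  ultimately have "fls_cong N (f * g) (f' * g')"
    by (subst fls_cong_iff_diff) (simp add: fls_cong_def)
  then show ?thesis
    using assms fls_cong_0_mult[of 0 f 0 g] fls_cong_0_mult[of 0 f' 0 g']
    by (simp add: fls_icong_def)
qed

lemma fls_icong_const: "fls_icong N (fls_const c) (fls_const c)"
  by (simp add: fls_icong_def fls_cong_def)

lemma fls_icong_of_int: "fls_icong N (of_int c) (of_int c)"
  by (metis fls_icong_const fls_of_int)

lemma fls_icong_0: "fls_icong N 0 0"
  using fls_icong_const[of N 0] by simp

lemma fls_icong_1: "fls_icong N 1 1"
  using fls_icong_const[of N 1] by simp

lemma fls_icong_power: "fls_icong N f g \<Longrightarrow> fls_icong N (f ^ n) (g ^ n)"
  by (induction n) (auto intro: fls_icong_mult fls_icong_1)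

lemma fls_icong_sum:
  "(\<And>i. i \<in> A \<Longrightarrow> fls_icong N (f i) (g i)) \<Longrightarrow> fls_icong N (\<Sum>i\<in>A. f i) (\<Sum>i\<in>A. g i)"
  by (induction A rule: infinite_finite_induct) (auto intro: fls_icong_add fls_icong_0)

lemma fls_icong_prod:
  "(\<And>i. i \<in> A \<Longrightarrow> fls_icong N (f i) (g i)) \<Longrightarrow> fls_icong N (\<Prod>i\<in>A. f i) (\<Prod>i\<in>A. g i)"
  by (induction A rule: infinite_finite_induct) (auto intro: fls_icong_mult fls_icong_1)

lemma fls_icong_poly_eval:
  assumes "\<And>v. fls_icong N (s v) (t v)"
  shows "fls_icong N (poly_eval s P) (poly_eval t P)"
  unfolding poly_eval_def mono_eval_def
  by (intro fls_icong_sum fls_icong_mult fls_icong_of_int fls_icong_prod fls_icong_power assms)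

section \<open>Congruences uniform in all components of Witt vectors\<close>

definition wcong :: "int \<Rightarrow> (nat \<Rightarrow> 'a::field fls) \<Rightarrow> (nat \<Rightarrow> 'a fls) \<Rightarrow> bool" where
  "wcong N x y \<longleftrightarrow> (\<forall>n. fls_icong N (x n) (y n))"

lemma wcong_sym: "wcong N x y \<Longrightarrow> wcong N y x"
  by (auto simp: wcong_def intro: fls_icong_sym)

lemma wcong_trans: "wcong N x y \<Longrightarrow> wcong N y z \<Longrightarrow> wcong N x z"
  by (auto simp: wcong_def intro: fls_icong_trans)

lemma wcong_mono: "wcong N x y \<Longrightarrow> M \<le> N \<Longrightarrow> wcong M x y"
  by (auto simp: wcong_def intro: fls_icong_mono)

text \<open>Reflexivity holds only for integral vectors; the hypothesis supplies that
  integrality.\<close>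

lemma wcong_refl: "wcong 0 x y \<Longrightarrow> wcong N x x"
  by (auto simp: wcong_def fls_icong_def)

lemma wcong_wmult: "wcong N x x' \<Longrightarrow> wcong N y y' \<Longrightarrow> wcong N (wmult p x y) (wmult p x' y')"
  unfolding wcong_def wmult_eq
  by (intro allI fls_icong_poly_eval) (auto split: sum.split)

lemma wcong_wadd: "wcong N x x' \<Longrightarrow> wcong N y y' \<Longrightarrow> wcong N (wadd p x y) (wadd p x' y')"
  unfolding wcong_def wadd_eq
  by (intro allI fls_icong_poly_eval) (auto split: sum.split)

lemma wcong_teichmueller: "fls_icong N a b \<Longrightarrow> wcong N (teichmueller a) (teichmueller b)"
  by (auto simp: wcong_def teichmueller_def fls_icong_0)

lemma wcong_wone: "wcong N wone wone"
  by (auto simp: wcong_def fls_icong_0 fls_icong_1)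

lemma wcong_finprod:
  fixes f g :: "'i \<Rightarrow> nat \<Rightarrow> 'a::field fls"
  assumes "prime p" "\<And>i. i \<in> F \<Longrightarrow> wcong N (f i) (g i)"
  shows "wcong N (finprod (witt_ring p) f F) (finprod (witt_ring p) g F)"
proof -
  interpret comm_monoid "witt_ring p :: (nat \<Rightarrow> 'a fls) ring"
    by (rule comm_monoid_witt_ring) fact
  show ?thesis
    using assms(2)
    by (induction F rule: infinite_finite_induct)
      (auto intro!: wcong_wmult simp: one_witt_ring wcong_wone)
qed

lemma wcong_finprod_wone:
  fixes f :: "'i \<Rightarrow> nat \<Rightarrow> 'a::field fls"
  assumes "prime p" "\<And>i. i \<in> F \<Longrightarrow> wcong N (f i) wone"
  shows "wcong N (finprod (witt_ring p) f F) wone"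
proof -
  interpret comm_monoid "witt_ring p :: (nat \<Rightarrow> 'a fls) ring"
    by (rule comm_monoid_witt_ring) fact
  show ?thesis
    using wcong_finprod[of p F N f "\<lambda>_. wone"] assms finprod_one_eqI[of F "\<lambda>_. wone"]
    by (simp add: one_witt_ring)
qed

lemma wcong_nat_pow_wone:
  fixes x :: "nat \<Rightarrow> 'a::field fls" and k :: nat
  assumes "prime p" "wcong N x wone"
  shows "wcong N (x [^]\<^bsub>witt_ring p\<^esub> k) wone"
proof -
  interpret comm_monoid "witt_ring p :: (nat \<Rightarrow> 'a fls) ring"
    by (rule comm_monoid_witt_ring) fact
  show ?thesis
  proof (induction k)
    case (Suc k)
    then show ?case
      using wcong_wmult[OF Suc assms(2), of p] wmult_one[OF assms(1), of "wone :: nat \<Rightarrow> 'a fls"]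
      by simp
  qed (simp add: one_witt_ring wcong_wone)
qed

lemma weqI_wcong:
  assumes "\<And>N :: nat. wcong (int N) x y"
  shows "x = y"
  using assms by (auto simp: wcong_def fls_icong_def intro: fls_eqI_cong)


section \<open>Convergence of infinite products\<close>

lemma Abs_fls_nonneg_nth:
  "Abs_fls (\<lambda>k. if k < 0 then 0 else f k) $$ k = (if k < 0 then 0 else f k)"
  by (rule nth_Abs_fls_lower_bound[of 0]) auto

lemma finprod_split_witt:
  fixes f :: "'i \<Rightarrow> nat \<Rightarrow> 'a::comm_ring_1"
  assumes "prime p" "finite F" "E \<subseteq> F"
  shows "finprod (witt_ring p) f F =
    wmult p (finprod (witt_ring p) f E) (finprod (witt_ring p) f (F - E))"
proof -
  interpret comm_monoid "witt_ring p :: (nat \<Rightarrow> 'a) ring"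
    by (rule comm_monoid_witt_ring) fact
  have "finprod (witt_ring p) f (E \<union> (F - E)) =
      wmult p (finprod (witt_ring p) f E) (finprod (witt_ring p) f (F - E))"
    using assms finite_subset by (intro finprod_Un_disjoint) auto
  moreover have "E \<union> (F - E) = F"
    using assms(3) by auto
  ultimately show ?thesis
    by simp
qed

text \<open>All partial products containing the finitely many factors that are not 1 modulo
  \<open>T^N\<close> agree modulo \<open>T^N\<close>. The conclusion keeps this explicit modulus,
  which a mere limit would lose, so that nested products can be compared with finite ones.\<close>

lemma integral_family_converges:
  fixes f :: "'i \<Rightarrow> nat \<Rightarrow> 'k::field fls"
  assumes p: "prime p"
    and integral: "\<And>i. i \<in> I \<Longrightarrow> wcong 0 (f i) wone"
    and fin: "\<And>N. finite {i\<in>I. \<not> wcong N (f i) wone}"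
  obtains y where "\<And>N F. finite F \<Longrightarrow> F \<subseteq> I \<Longrightarrow> {i\<in>I. \<not> wcong N (f i) wone} \<subseteq> F \<Longrightarrow>
    wcong N (finprod (witt_ring p) f F) y"
proof -
  define E where "E N = {i\<in>I. \<not> wcong N (f i) wone}" for N
  define \<pi> where "\<pi> = finprod (witt_ring p) f"
  have finE: "finite (E N)" for N
    using fin by (simp add: E_def)
  have EI: "E N \<subseteq> I" for N
    by (auto simp: E_def)
  have integral_\<pi>: "wcong 0 (\<pi> F) wone" if "F \<subseteq> I" for F
    unfolding \<pi>_def using that integral by (intro wcong_finprod_wone p) auto
  have stable: "wcong N (\<pi> F) (\<pi> (E N))" if F: "finite F" "F \<subseteq> I" "E N \<subseteq> F" for N F
  proof -
    have "wcong N (\<pi> (F - E N)) wone"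
      unfolding \<pi>_def using F by (intro wcong_finprod_wone p) (auto simp: E_def)
    then have "wcong N (wmult p (\<pi> (E N)) (\<pi> (F - E N))) (wmult p (\<pi> (E N)) wone)"
      by (intro wcong_wmult wcong_refl[OF integral_\<pi>] EI)
    moreover have "wmult p (\<pi> (E N)) wone = \<pi> (E N)"
      by (simp only: wmult_commute[OF p, of _ wone] wmult_one[OF p])
    ultimately show ?thesis
      using finprod_split_witt[OF p F(1,3), of f] by (simp only: \<pi>_def)
  qed
  \<comment> \<open>The coefficient at \<open>k\<close> is settled modulo \<open>T^(k+1)\<close>,
    hence read off from \<open>E (k + 1)\<close>; below 0 all coefficients vanish by
    integrality.\<close>
  define y where "y n = Abs_fls (\<lambda>k. if k < 0 then 0 else \<pi> (E (k + 1)) n $$ k)" for n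
  have y_nth: "y n $$ k = (if k < 0 then 0 else \<pi> (E (k + 1)) n $$ k)" for n k
    by (simp add: y_def Abs_fls_nonneg_nth)
  have "wcong N (\<pi> F) y" if F: "finite F" "F \<subseteq> I" "E N \<subseteq> F" for N F
  proof -
    have "\<pi> F n $$ k = y n $$ k" if "k < N" for n k
    proof (cases "k < 0")
      case True
      then show ?thesis
        using integral_\<pi>[OF F(2)] by (simp add: y_nth wcong_def fls_icong_def fls_cong_def)
    next
      case False
      have "E (k + 1) \<subseteq> E N"
        using that wcong_mono[of N _ _ "k + 1"] by (auto simp: E_def)
      then have "wcong (k + 1) (\<pi> F) (\<pi> (E (k + 1)))"
        using F by (intro stable) auto
      then show ?thesis
        using False by (simp add: y_nth wcong_def fls_icong_def fls_cong_def)
    qed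
    then show ?thesis
      using integral_\<pi>[OF F(2)] by (simp add: wcong_def fls_icong_def fls_cong_def y_nth)
  qed
  then show ?thesis
    using that[of y] by (simp add: E_def \<pi>_def)
qed

lemma tendsto_finite_subsets_wcong:
  fixes f :: "'i \<Rightarrow> nat \<Rightarrow> 'k::field fls"
  assumes fin: "\<And>N. finite {i\<in>I. \<not> wcong N (f i) wone}"
    and y: "\<And>N F. finite F \<Longrightarrow> F \<subseteq> I \<Longrightarrow> {i\<in>I. \<not> wcong N (f i) wone} \<subseteq> F \<Longrightarrow>
      wcong N (finprod (witt_ring p) f F) y"
  shows "((\<lambda>F. finprod (witt_ring p) f F n) \<longlongrightarrow> y n) (finite_subsets_at_top I)"
  unfolding tendsto_fls_iff eventually_finite_subsets_at_top
proof
  fix N :: nat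
  let ?E = "{i\<in>I. \<not> wcong (int N) (f i) wone}"
  show "\<exists>X. finite X \<and> X \<subseteq> I \<and> (\<forall>Y. finite Y \<and> X \<subseteq> Y \<and> Y \<subseteq> I \<longrightarrow>
      fls_cong (int N) (finprod (witt_ring p) f Y n) (y n))"
    by (rule exI[of _ ?E]) (use fin y in \<open>auto simp: wcong_def fls_icong_def\<close>)
qed

text \<open>The case \<open>N = 0\<close> of the hypothesis says that only finitely many factors,
  those in \<open>E\<close>, can have poles. The others converge by the integral case, and
  multiplication by the fixed product over \<open>E\<close> is continuous.\<close>

lemma finprod_converges:
  fixes f :: "'i \<Rightarrow> nat \<Rightarrow> 'k::field fls"
  assumes p: "prime p"
    and fin: "\<And>N. finite {i\<in>I. \<not> wcong N (f i) wone}"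
  obtains y where
    "\<And>n. ((\<lambda>F. finprod (witt_ring p) f F n) \<longlongrightarrow> y n) (finite_subsets_at_top I)"
proof -
  define E where "E = {i\<in>I. \<not> wcong 0 (f i) wone}"
  have E: "finite E" "E \<subseteq> I"
    using fin by (auto simp: E_def)
  have fin': "finite {i\<in>I - E. \<not> wcong N (f i) wone}" for N
    by (rule finite_subset[OF _ fin[of N]]) auto
  obtain z where z: "\<And>N F. finite F \<Longrightarrow> F \<subseteq> I - E \<Longrightarrow>
      {i\<in>I - E. \<not> wcong N (f i) wone} \<subseteq> F \<Longrightarrow> wcong N (finprod (witt_ring p) f F) z"
    using integral_family_converges[OF p _ fin'] by (auto simp: E_def)
  have z_lim: "((\<lambda>F. finprod (witt_ring p) f F n) \<longlongrightarrow> z n) (finite_subsets_at_top (I - E))" for n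
    by (rule tendsto_finite_subsets_wcong[OF fin' z])
  \<comment> \<open>Transfers the limit over finite subsets of \<open>I - E\<close> to the net of
    all finite subsets of \<open>I\<close>.\<close>
  have "filterlim (\<lambda>F. F - E) (finite_subsets_at_top (I - E)) (finite_subsets_at_top I)"
    unfolding filterlim_def le_filter_def eventually_filtermap eventually_finite_subsets_at_top
  proof (intro allI impI, elim exE conjE)
    fix P X
    assume X: "finite X" "X \<subseteq> I - E" "\<forall>Y. finite Y \<and> X \<subseteq> Y \<and> Y \<subseteq> I - E \<longrightarrow> P Y"
    show "\<exists>X. finite X \<and> X \<subseteq> I \<and> (\<forall>Y. finite Y \<and> X \<subseteq> Y \<and> Y \<subseteq> I \<longrightarrow> P (Y - E))"
    proof (intro exI[of _ X] conjI allI impI)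
      fix Y assume "finite Y \<and> X \<subseteq> Y \<and> Y \<subseteq> I"
      with X(2) have "finite (Y - E) \<and> X \<subseteq> Y - E \<and> Y - E \<subseteq> I - E"
        by auto
      with X(3) show "P (Y - E)"
        by blast
    qed (use X in auto)
  qed
  from filterlim_compose[OF z_lim this]
  have lim: "((\<lambda>F. wmult p (finprod (witt_ring p) f E) (finprod (witt_ring p) f (F - E)) n) \<longlongrightarrow>
      wmult p (finprod (witt_ring p) f E) z n) (finite_subsets_at_top I)" for n
    by (intro tendsto_wmult tendsto_const)
  have "eventually (\<lambda>F. wmult p (finprod (witt_ring p) f E) (finprod (witt_ring p) f (F - E)) n =
      finprod (witt_ring p) f F n) (finite_subsets_at_top I)" for n
    unfolding eventually_finite_subsets_at_top
  proof (intro exI[of _ E] conjI allI impI)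
    fix F assume F: "finite F \<and> E \<subseteq> F \<and> F \<subseteq> I"
    show "wmult p (finprod (witt_ring p) f E) (finprod (witt_ring p) f (F - E)) n =
        finprod (witt_ring p) f F n"
      by (rule fun_cong[OF finprod_split_witt[OF p, symmetric]]) (use F in auto)
  qed (use E in auto)
  from Lim_transform_eventually[OF lim this] show ?thesis
    by (rule that)
qed

text \<open>Every finite partial product lies in \<open>1 + V^m W\<close>, with the sum of the
  entries at index \<open>m\<close>; both facts pass to the limit, since limits are unique.\<close>

lemma witt_has_prod_one_below:
  fixes f :: "'i \<Rightarrow> nat \<Rightarrow> 'k::field fls"
  assumes p: "prime p" and char: "of_nat p = (0 :: 'k fls)"
    and fin: "\<And>N. finite {i\<in>I. \<not> wcong N (f i) wone}"
    and m: "0 < m" and f: "\<And>i. i \<in> I \<Longrightarrow> one_below m (f i)"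
    and lim: "((\<lambda>F. \<Sum>i\<in>F. f i m) \<longlongrightarrow> s) (finite_subsets_at_top I)"
  obtains y where "witt_has_prod p f I y" "one_below m y" "y m = s"
proof -
  obtain y where y: "\<And>n. ((\<lambda>F. finprod (witt_ring p) f F n) \<longlongrightarrow> y n) (finite_subsets_at_top I)"
    using finprod_converges[OF p fin] by blast
  have unique: "y n = l" if "((\<lambda>F. g F) \<longlongrightarrow> l) (finite_subsets_at_top I)"
    "\<And>F. F \<subseteq> I \<Longrightarrow> finprod (witt_ring p) f F n = g F" for g n l
  proof (rule tendsto_unique[OF _ y[of n]])
    show "((\<lambda>F. finprod (witt_ring p) f F n) \<longlongrightarrow> l) (finite_subsets_at_top I)"
      by (rule Lim_transform_eventually[OF that(1)])
        (use that(2) in \<open>auto simp: eventually_finite_subsets_at_top\<close>)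
  qed simp
  have below: "y i = wone i" if "i < m" for i
    by (rule unique[OF tendsto_const])
      (use f that one_below_finprod[OF p, of _ m f] in \<open>auto simp: one_below_def subset_iff\<close>)
  have "y m = s"
    by (rule unique[OF lim]) (use f m in \<open>auto intro!: finprod_one_below_nth[OF p char]\<close>)
  moreover have "y \<in> Units (witt_ring p)" "f ` I \<subseteq> Units (witt_ring p)"
    using below[of 0] f m by (auto simp: Units_witt_ring_iff[OF p char] one_below_def)
  ultimately show ?thesis
    using that[of y] below y by (simp add: witt_has_prod_def one_below_def)
qed

text \<open>Component \<open>n\<close> of the partial products becomes constant: factors from index
  \<open>a + n\<close> on are 1 up to and including component \<open>n\<close>.\<close>

lemma witt_has_prod_eventually_eq:
  fixes f :: "nat \<Rightarrow> nat \<Rightarrow> 'k::field fls"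
  assumes p: "prime p" and char: "of_nat p = (0 :: 'k fls)"
    and f: "\<And>i. a \<le> i \<Longrightarrow> f i 0 \<noteq> 0" and y: "y 0 \<noteq> 0"
    and below: "\<And>n i. a + n \<le> i \<Longrightarrow> one_below (Suc n) (f i)"
    and eq: "\<And>n. finprod (witt_ring p) f {a..<a + n} n = y n"
  shows "witt_has_prod p f {a..} y"
proof -
  have "((\<lambda>F. finprod (witt_ring p) f F n) \<longlongrightarrow> y n) (finite_subsets_at_top {a..})" for n
  proof (rule tendsto_eventually)
    show "eventually (\<lambda>F. finprod (witt_ring p) f F n = y n) (finite_subsets_at_top {a..})"
      unfolding eventually_finite_subsets_at_top
    proof (intro exI[of _ "{a..<a + n}"] conjI allI impI)
      fix F assume F: "finite F \<and> {a..<a + n} \<subseteq> F \<and> F \<subseteq> {a..}"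
      have "one_below (Suc n) (finprod (witt_ring p) f (F - {a..<a + n}))"
        using F by (intro one_below_finprod[OF p] below) auto
      from wmult_one_below_left[OF p this] show "finprod (witt_ring p) f F n = y n"
        using F finprod_split_witt[OF p, of F "{a..<a + n}" f] eq by metis
    qed auto
  qed
  then show ?thesis
    using f y by (auto simp: witt_has_prod_def Units_witt_ring_iff[OF p char])
qed


section \<open>The prime field\<close>

text \<open>Translation by 1 permutes the ring, so adding 1 to each summand leaves the sum of all
  elements unchanged.\<close>

lemma of_nat_CARD_eq_0: "of_nat CARD('a) = (0 :: 'a::{ring_1,finite})"
proof -
  have "(\<Sum>a\<in>UNIV. a + 1) = (\<Sum>a\<in>UNIV. a :: 'a)"
    by (rule sum.reindex_bij_witness[of _ "\<lambda>a. a - 1" "\<lambda>a. a + 1"]) auto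
  then show ?thesis
    by (simp add: sum.distrib)
qed

text \<open>The characteristic is \<open>p\<close>, so \<open>0, ..., p - 1\<close> have distinct
  images, which fill the field by counting. Coefficients can thus be lifted to exponents.\<close>

lemma prime_field_of_nat:
  assumes "prime p" "CARD('k::{field,finite}) = p"
  shows "\<exists>m<p. of_nat m = (a :: 'k)"
proof -
  have "CHAR('k) dvd p"
    using of_nat_CARD_eq_0[where 'a = 'k] assms(2) by (simp add: of_nat_eq_0_iff_char_dvd)
  moreover have "CHAR('k) \<noteq> 1"
    using of_nat_CHAR[where 'a = 'k] by (metis of_nat_1 one_neq_zero)
  ultimately have char: "CHAR('k) = p"
    using assms(1) by (auto simp: prime_nat_iff)
  have eq: "i = j" if "i \<le> j" "j < p" "of_nat i = (of_nat j :: 'k)" for i j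
  proof -
    have "of_nat (j - i) = (0 :: 'k)"
      using that by (simp add: of_nat_diff)
    then have "p dvd j - i"
      by (simp add: of_nat_eq_0_iff_char_dvd char)
    then show ?thesis
      using that by (auto dest!: dvd_imp_le)
  qed
  have "inj_on (of_nat :: nat \<Rightarrow> 'k) {..<p}"
  proof (rule inj_onI)
    fix i j assume "i \<in> {..<p}" "j \<in> {..<p}" "of_nat i = (of_nat j :: 'k)"
    then show "i = j"
      using eq[of i j] eq[of j i] by (cases "i \<le> j") auto
  qed
  then have "(of_nat :: nat \<Rightarrow> 'k) ` {..<p} = UNIV"
    using assms(2) by (intro card_subset_eq) (auto simp: card_image)
  then show ?thesis
    by (metis UNIV_I imageE lessThan_iff)
qed

lemma prime_field_power:
  assumes "prime p" "CARD('k::{field,finite}) = p"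
  shows "(a :: 'k) ^ (p ^ k) = a"
proof -
  have power_p: "a ^ p = a" for a :: 'k
  proof -
    obtain m where m: "a = of_nat m"
      using prime_field_of_nat[OF assms] by metis
    obtain q where "int m ^ p - int m = int p * q"
      using prime_dvd_int_power_diff[OF assms(1), of "int m"] by (elim dvdE)
    from arg_cong[OF this, of "of_int :: int \<Rightarrow> 'k"] show ?thesis
      using of_nat_CARD_eq_0[where 'a = 'k] assms(2) by (simp add: m)
  qed
  show ?thesis
    by (induction k) (simp_all add: power_p power_mult)
qed

lemma one_minus_power_p:
  fixes z :: "'a::comm_ring_1"
  assumes "prime p" "of_nat p = (0 :: 'a)"
  shows "(1 - z) ^ (p ^ k) = 1 - z ^ (p ^ k)"
proof (induction k)
  case (Suc k)
  \<comment> \<open>Taking the sum \<open>(1 - w) + w\<close> avoids the sign of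
    \<open>(- w) ^ p\<close>, so \<open>p = 2\<close> is no exception.\<close>
  have "(1 - w) ^ p = 1 - w ^ p" for w :: 'a
    using prime_dvd_add_power_diff[OF assms(1), of "1 - w" w] assms(2) by (simp add: eq_diff_eq)
  then show ?case
    using Suc by (simp add: power_mult mult.commute[of p])
qed simp


section \<open>Expansion of a principal unit of the power series ring\<close>

definition unit_monom :: "(nat \<Rightarrow> 'a) \<Rightarrow> nat \<Rightarrow> 'a::field fls" where
  "unit_monom a n = 1 - fls_const (a n) * fls_X ^ n"

lemma mult_const_X_power_nth:
  "(G * (fls_const r * fls_X ^ n)) $$ k = r * (G $$ (k - int n) :: 'a::field)"
proof -
  have "G * (fls_const r * fls_X ^ n) = fls_const r * (fls_X ^ n * G)"
    by (simp add: mult_ac)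
  then show ?thesis
    by (simp add: fls_X_power_times_conv_shift)
qed

lemma fls_icong_unit_monom: "fls_icong (int n) (unit_monom a n) 1"
proof -
  have "(fls_const (a n) * fls_X ^ n) $$ k = (if k = int n then a n else 0)" for k
    using mult_const_X_power_nth[of 1 "a n" n k] by auto
  then show ?thesis
    by (auto simp: fls_icong_def fls_cong_def unit_monom_def)
qed

lemma principal_unit_expansion:
  fixes g :: "'a::field fls"
  assumes g: "fls_icong 1 g 1"
  shows "\<exists>a. \<forall>N. fls_icong (int N) (\<Prod>n\<in>{1..<N}. unit_monom a n) g"
proof -
  define G where "G a N = (\<Prod>n\<in>{1..<N}. unit_monom a n)" for a :: "nat \<Rightarrow> 'a" and N
  have G1: "fls_icong 1 (G a N) 1" for a N
  proof -
    have "fls_icong 1 (G a N) (\<Prod>n\<in>{1..<N}. 1)"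
      unfolding G_def
      by (intro fls_icong_prod) (auto intro: fls_icong_mono[OF fls_icong_unit_monom])
    then show ?thesis
      by simp
  qed
  \<comment> \<open>As \<open>G a n\<close> has constant term 1, the factor
    \<open>1 - a n * T^n\<close> lowers its coefficient at \<open>n\<close> by \<open>a n\<close>;
    this is chosen to be the discrepancy with \<open>g\<close>. \<open>G a n\<close> involves only
    earlier values of \<open>a\<close>.\<close>
  have "\<exists>a. \<forall>n. a n = G a n $$ int n - g $$ int n"
  proof (rule dependent_wellorder_choice)
    fix r and a b :: "nat \<Rightarrow> 'a" and n
    assume "\<And>m. m < n \<Longrightarrow> a m = b m"
    then have "G a n = G b n"
      by (auto simp: G_def unit_monom_def intro!: prod.cong)
    then show "(r = G a n $$ int n - g $$ int n) = (r = G b n $$ int n - g $$ int n)"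
      by simp
  qed simp
  then obtain a where a: "\<And>n. a n = G a n $$ int n - g $$ int n"
    by blast
  have "fls_cong (int N) (G a N) g" for N
  proof (induction N)
    case 0
    show ?case
      using G1[of a 0] g by (auto simp: fls_icong_def fls_cong_def)
  next
    case (Suc N)
    show ?case
    proof (cases "N = 0")
      case True
      then show ?thesis
        using g by (auto simp: G_def fls_icong_def fls_cong_def)
    next
      case False
      have "G a (Suc N) = G a N - G a N * (fls_const (a N) * fls_X ^ N)"
        using False by (simp add: G_def unit_monom_def atLeastLessThanSuc algebra_simps)
      then have nth: "G a (Suc N) $$ k = G a N $$ k - a N * G a N $$ (k - int N)" for k
        by (simp add: mult_const_X_power_nth)
      have "G a N $$ 0 = 1" "\<And>k. k < 0 \<Longrightarrow> G a N $$ k = 0"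
        using G1[of a N] by (auto simp: fls_icong_def fls_cong_def)
      then have "G a (Suc N) $$ k = g $$ k" if "k < int (Suc N)" for k
        using that Suc a[of N] by (cases "k = int N") (auto simp: nth fls_cong_def)
      then show ?thesis
        by (simp add: fls_cong_def)
    qed
  qed
  then show ?thesis
    using G1 g by (intro exI[of _ a]) (auto simp: G_def fls_icong_def)
qed

lemma principal_unit_normalization:
  fixes f :: "'a::field fls"
  assumes "f \<noteq> 0"
  obtains c g where "c \<noteq> 0" "f = fls_const c * fls_X powi fls_subdegree f * g" "fls_icong 1 g 1"
proof -
  define c where "c = f $$ fls_subdegree f"
  define g where "g = fls_const (inverse c) * fls_shift (fls_subdegree f) f"
  have c: "c \<noteq> 0"
    using assms by (simp add: c_def)
  have "fls_const c * fls_X powi fls_subdegree f * g =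
      (fls_const c * fls_const (inverse c)) * (fls_X powi fls_subdegree f * fls_shift (fls_subdegree f) f)"
    by (simp add: g_def mult_ac)
  also have "\<dots> = f"
    using c by (simp add: fls_X_intpow_times_conv_shift fls_const_mult_const)
  finally have "f = fls_const c * fls_X powi fls_subdegree f * g" ..
  moreover have "fls_icong 1 g 1"
    using c by (auto simp: fls_icong_def fls_cong_def g_def c_def)
  ultimately show ?thesis
    using that c by blast
qed


section \<open>The elements \<open>u\<^bsub>m,n\<^esub>\<close>\<close>

lemma verschiebung_funpow_nth:
  "(verschiebung ^^ k) x n = (if n < k then 0 else x (n - k))"
  by (induction k arbitrary: n) (auto simp: verschiebung_def split: nat.split)

lemma one_below_witt_u:
  assumes p: "prime p" and m: "0 < m"
  shows "one_below m (witt_u p i (Suc m) :: nat \<Rightarrow> 'k::field fls)"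
    and "witt_u p i (Suc m) m = (fls_X powi i :: 'k fls)"
proof -
  let ?u = "witt_u p i (Suc m) :: nat \<Rightarrow> 'k fls"
  let ?v = "(verschiebung ^^ m) (teichmueller (fls_X powi i)) :: nat \<Rightarrow> 'k fls"
  \<comment> \<open>Compares \<open>?v\<close> with the zero vector. They agree before index
    \<open>m\<close>, so \<open>wadd_diff\<close> applies for \<open>j\<close> up to
    \<open>m\<close>.\<close>
  have *: "?u j = wone j + ?v j" if "j \<le> m" for j
    using wadd_diff[OF p, of j ?v "\<lambda>_. 0" wone] that
    by (simp add: witt_u_def one_witt_ring wadd_zero[OF p] verschiebung_funpow_nth algebra_simps)
  show "one_below m ?u"
    using * by (simp add: one_below_def verschiebung_funpow_nth)
  show "?u m = fls_X powi i"
    using *[of m] m by (simp add: verschiebung_funpow_nth teichmueller_def)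
qed

lemma wcong_witt_u:
  assumes p: "prime p" and "N \<le> i" "0 \<le> i"
  shows "wcong N (witt_u p i n) wone"
proof -
  have "fls_icong N (fls_X powi i) 0"
    using assms by (auto simp: fls_icong_def fls_cong_def)
  then have "wcong N ((verschiebung ^^ (n - 1)) (teichmueller (fls_X powi i))) (\<lambda>_. 0)"
    by (auto simp: wcong_def verschiebung_funpow_nth teichmueller_def fls_icong_0)
  from wcong_wadd[OF wcong_wone this, of p] show ?thesis
    by (simp add: witt_u_def one_witt_ring wadd_zero[OF p])
qed

text \<open>The exponents lift the coefficients of \<open>r m\<close> to integers below
  \<open>p\<close>, and the product starts at the subdegree of \<open>r m\<close>. At index
  \<open>m\<close> the product is then the expansion of \<open>r m\<close> in powers of
  \<open>T\<close>.\<close>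

lemma witt_u_product:
  fixes r :: "nat \<Rightarrow> 'k::{field,finite} fls"
  assumes p: "prime p" and card: "CARD('k) = p" and m: "0 < m"
  obtains e b q where "\<And>i. e i \<in> {0..p - 1}"
    and "witt_has_prod p (\<lambda>i. witt_u p i (Suc m) [^]\<^bsub>witt_ring p\<^esub> (e i :: nat)) {b..} q"
    and "one_below m q" "q m = r m"
proof -
  have "\<forall>i. \<exists>j. j < p \<and> of_nat j = r m $$ i"
    using prime_field_of_nat[OF p card] by blast
  then obtain e where e: "\<And>i. e i < p" "\<And>i. of_nat (e i) = r m $$ i"
    by metis
  define b where "b = fls_subdegree (r m)"
  let ?f = "\<lambda>i. witt_u p i (Suc m) [^]\<^bsub>witt_ring p\<^esub> e i :: nat \<Rightarrow> 'k fls"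
  have char: "of_nat p = (0 :: 'k fls)"
    using of_nat_CARD_eq_0[where 'a = 'k] card by (simp add: fls_of_nat)
  have fin: "finite {i\<in>{b..}. \<not> wcong N (?f i) wone}" for N
  proof (rule finite_subset)
    \<comment> \<open>The maximum with 0 keeps negative \<open>i\<close> in the bounding set even
      when \<open>N\<close> is negative, since those factors can have poles.\<close>
    show "{i\<in>{b..}. \<not> wcong N (?f i) wone} \<subseteq> {b..<max N 0}"
    proof
      fix i assume i: "i \<in> {i\<in>{b..}. \<not> wcong N (?f i) wone}"
      then have "\<not> (N \<le> i \<and> 0 \<le> i)"
        using wcong_nat_pow_wone[OF p wcong_witt_u[OF p, of N i "Suc m"], of "e i"] by blast
      with i show "i \<in> {b..<max N 0}"
        by auto
    qed
  qed simp
  have below: "one_below m (?f i)" for i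
    by (intro one_below_nat_pow[OF p] one_below_witt_u p m)
  have nth: "?f i m = fls_const (r m $$ i) * fls_X powi i" for i
    using nat_pow_one_below_nth[OF p char m one_below_witt_u(1)[OF p m]]
      one_below_witt_u(2)[where 'k = 'k, OF p m]
    by (simp add: e(2) fls_of_nat)
  have "((\<lambda>F. \<Sum>i\<in>F. ?f i m) \<longlongrightarrow> r m) (finite_subsets_at_top {b..})"
    unfolding tendsto_fls_iff eventually_finite_subsets_at_top
  proof (intro allI exI conjI impI)
    fix N :: nat and F
    assume F: "finite F \<and> {b..<int N} \<subseteq> F \<and> F \<subseteq> {b..}"
    have "(\<Sum>i\<in>F. ?f i m) $$ k = r m $$ k" if "k < int N" for k
    proof -
      have "(\<Sum>i\<in>F. ?f i m) $$ k = (\<Sum>i\<in>F. if i = k then r m $$ i else 0)"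
        by (simp only: nth fls_nth_sum) (auto intro!: sum.cong)
      also have "\<dots> = (if k \<in> F then r m $$ k else 0)"
        using F by simp
      \<comment> \<open>Since \<open>F\<close> contains \<open>{b..<int N}\<close>, an index
        \<open>k\<close> below \<open>N\<close> missing from \<open>F\<close> lies below
        \<open>b\<close>, where \<open>r m\<close> has no coefficient.\<close>
      also have "\<dots> = r m $$ k"
      proof (cases "k \<in> F")
        case False
        with F that have "k < b"
          by (meson atLeastLessThan_iff not_le subset_iff)
        with False show ?thesis
          by (simp add: b_def fls_eq0_below_subdegree)
      qed simp
      finally show ?thesis .
    qed
    then show "fls_cong (int N) (\<Sum>i\<in>F. ?f i m) (r m)"
      by (simp add: fls_cong_def)
  qed auto
  then obtain q where "witt_has_prod p ?f {b..} q" "one_below m q" "q m = r m"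
    using witt_has_prod_one_below[OF p char fin m below] by blast
  moreover have "e i \<in> {0..p - 1}" for i
    using e(1)[of i] by simp
  ultimately show ?thesis
    using that by blast
qed

text \<open>For \<open>s\<close> the quotient of \<open>r\<close> by \<open>q\<close>, as long as
  \<open>s\<close> is 1 below \<open>i > 0\<close> one has \<open>r i = q i + s i\<close>; equality
  of \<open>r\<close> and \<open>q\<close> up to index \<open>m\<close> forces
  \<open>s i = 0\<close>.\<close>

lemma one_below_Suc_quotient:
  fixes q r :: "nat \<Rightarrow> 'a::field"
  assumes p: "prime p" and char: "of_nat p = (0 :: 'a)" and m: "0 < m"
    and q: "one_below m q" and r: "one_below m r" and eq: "q m = r m"
  obtains s where "r = wmult p q s" "one_below (Suc m) s"
proof -
  interpret comm_monoid "witt_ring p :: (nat \<Rightarrow> 'a) ring"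
    by (rule comm_monoid_witt_ring) fact
  have q0: "q 0 = 1" and r0: "r 0 = 1"
    using q r m by (auto simp: one_below_def)
  have "q \<in> Units (witt_ring p)"
    using q0 by (simp add: Units_witt_ring_iff[OF p char])
  then obtain q' where q': "wmult p q q' = wone"
    by (auto simp: Units_def one_witt_ring)
  define s where "s = wmult p q' r"
  have r_eq: "wmult p q s = r"
    by (simp add: s_def q' wmult_one[OF p] flip: wmult_assoc[OF p])
  have "s i = wone i" if "i < Suc m" for i
    using that
  proof (induction i rule: less_induct)
    case (less i)
    show ?case
    proof (cases "i = 0")
      case True
      then show ?thesis
        using fun_cong[OF r_eq, of 0] q0 r0 by (simp add: wmult_0[OF p])
    next
      case False
      have "one_below i s"
        using less by (simp add: one_below_def)
      moreover have "one_below i q"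
        using q less.prems by (intro one_below_mono[OF q]) simp
      ultimately have "r i = q i + s i"
        using wmult_one_below_nth[OF p char, of i q s] False r_eq by simp
      moreover have "q i = r i"
        using less.prems q r eq by (cases "i = m") (auto simp: one_below_def)
      ultimately show ?thesis
        using False by simp
    qed
  qed
  then show ?thesis
    using that[of s] r_eq by (simp add: one_below_def)
qed


section \<open>The two factors\<close>

lemma coprime_times_prime_power_inj:
  assumes "prime p"
  shows "inj_on (\<lambda>(k, j). j * p ^ k) (UNIV \<times> {j::nat. coprime j p})"
proof (rule inj_onI, clarify)
  fix k j k' j' :: nat
  assume j: "coprime j p" "coprime j' p" and eq: "j * p ^ k = j' * p ^ k'"
  have ndvd: "\<not> p dvd j" "\<not> p dvd j'"
    using j assms by (metis coprime_absorb_right coprime_commute not_prime_unit)+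
  have "k = k'"
    using prime_power_cancel[OF assms eq ndvd] .
  with eq assms show "k = k' \<and> j = j'"
    by auto
qed

text \<open>The bounds on \<open>k\<close> and \<open>j\<close> ensure that a finite box of pairs
  reaches every exponent below a given \<open>N\<close>.\<close>

lemma coprime_times_prime_power_cover:
  fixes n :: nat
  assumes "prime p" "0 < n"
  obtains k j where "n = j * p ^ k" "0 < j" "coprime j p" "k < n" "j \<le> n"
proof -
  obtain j where j: "n = p ^ multiplicity p n * j" "\<not> p dvd j"
    using multiplicity_decompose'[of n p] assms not_prime_unit by blast
  have "1 < p"
    using assms(1) prime_gt_1_nat by blast
  then have "multiplicity p n < p ^ multiplicity p n"
    by (intro power_gt_expt) simp
  moreover have "p ^ multiplicity p n \<le> n"
    using assms(2) multiplicity_dvd[of p n] by (simp add: dvd_imp_le)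
  moreover have "0 < j"
    using j assms(2) by (cases j) auto
  moreover have "j \<le> n"
    using j(1) assms(2) by (metis dvd_imp_le dvd_triv_right)
  moreover have "coprime j p"
    using assms(1) j(2) prime_imp_coprime coprime_commute by blast
  ultimately show ?thesis
    using that[of j "multiplicity p n"] j(1) by (simp add: mult.commute)
qed

lemma teichmueller_principal_unit_expansion:
  fixes g :: "'k::{field,finite} fls"
  assumes p: "prime p" and card: "CARD('k) = p" and g: "fls_icong 1 g 1"
  obtains cc P where
    "\<And>k. witt_has_prod p
       (\<lambda>j. teichmueller (1 - fls_const (cc j k) * fls_X ^ j) [^]\<^bsub>witt_ring p\<^esub> (p ^ k))
       {j. 0 < j \<and> coprime j p} (P k)"
    "witt_has_prod p P {0..} (teichmueller g)"
proof -
  let ?J = "{j. 0 < j \<and> coprime j p}"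
  have char: "of_nat p = (0 :: 'k fls)"
    using of_nat_CARD_eq_0[where 'a = 'k] card by (simp add: fls_of_nat)
  obtain a where a: "\<And>N. fls_icong (int N) (\<Prod>n\<in>{1..<N}. unit_monom a n) g"
    using principal_unit_expansion[OF g] by blast
  define h where "h k j = teichmueller (unit_monom a (j * p ^ k))" for k j
  have p1: "1 < p"
    using p prime_gt_1_nat by blast
  have h_eq: "teichmueller (1 - fls_const (a (j * p ^ k)) * fls_X ^ j) [^]\<^bsub>witt_ring p\<^esub> (p ^ k) = h k j"
    for k j
  proof -
    have "(fls_const (a (j * p ^ k)) * fls_X ^ j) ^ (p ^ k) =
        fls_const (a (j * p ^ k)) * fls_X ^ (j * p ^ k)"
      by (simp add: power_mult_distrib prime_field_power[OF p card] flip: power_mult fls_const_power)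
    then show ?thesis
      by (simp add: h_def unit_monom_def teichmueller_nat_pow[OF p] one_minus_power_p[OF p char])
  qed
  have h_cong: "wcong N (h k j) wone" if "N \<le> int (j * p ^ k)" for N k j
    unfolding h_def wone_eq_teichmueller
    by (intro wcong_teichmueller fls_icong_mono[OF fls_icong_unit_monom that])
  have le_pk: "j \<le> j * p ^ k" "0 < j \<Longrightarrow> p ^ k \<le> j * p ^ k" for j k
    using p1 by simp_all
  have bad_j: "{j\<in>?J. \<not> wcong N (h k j) wone} \<subseteq> {j\<in>?J. j < nat N}" for N k
  proof
    fix j assume j: "j \<in> {j\<in>?J. \<not> wcong N (h k j) wone}"
    then have "int (j * p ^ k) < N"
      using h_cong[of N j k] by fastforce
    then have "int j < N"
      using le_pk(1)[of j k] by linarith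
    with j show "j \<in> {j\<in>?J. j < nat N}"
      by auto
  qed
  have fin_j: "finite {j\<in>?J. \<not> wcong N (h k j) wone}" for N k
    by (rule finite_subset[OF bad_j]) simp
  \<comment> \<open>The inner products are obtained with their modulus, because the final comparison
    replaces each \<open>P k\<close> by a finite product modulo \<open>T^N\<close>.\<close>
  have "\<exists>y. \<forall>N F. finite F \<and> F \<subseteq> ?J \<and> {j\<in>?J. \<not> wcong N (h k j) wone} \<subseteq> F \<longrightarrow>
      wcong N (finprod (witt_ring p) (h k) F) y" for k
  proof -
    have "wcong 0 (h k j) wone" for j
      by (rule h_cong) simp
    from integral_family_converges[OF p this fin_j] show ?thesis
      by (smt (verit))
  qed
  from choice[OF allI[OF this]]
  obtain P where "\<forall>k N F. finite F \<and> F \<subseteq> ?J \<and> {j\<in>?J. \<not> wcong N (h k j) wone} \<subseteq> F \<longrightarrow>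
      wcong N (finprod (witt_ring p) (h k) F) (P k)"
    by (rule exE)
  then have P: "finite F \<Longrightarrow> F \<subseteq> ?J \<Longrightarrow> {j\<in>?J. \<not> wcong N (h k j) wone} \<subseteq> F \<Longrightarrow>
      wcong N (finprod (witt_ring p) (h k) F) (P k)" for k N F
    by blast
  have P_lim: "((\<lambda>F. finprod (witt_ring p) (h k) F n) \<longlongrightarrow> P k n) (finite_subsets_at_top ?J)" for k n
    by (rule tendsto_finite_subsets_wcong[OF fin_j P])
  interpret comm_monoid "witt_ring p :: (nat \<Rightarrow> 'k fls) ring"
    by (rule comm_monoid_witt_ring) fact
  \<comment> \<open>Every exponent \<open>j * p ^ k\<close> is at least \<open>p ^ k\<close>, so no
    factor is exceptional and the empty product already approximates \<open>P k\<close>.\<close>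
  have P_cong: "wcong N (P k) wone" if "N \<le> int (p ^ k)" for N k
  proof -
    have "wcong N (h k j) wone" if "0 < j" for j
      using h_cong[of N j k] le_pk(2)[OF that, of k] \<open>N \<le> int (p ^ k)\<close> by linarith
    then have "{j\<in>?J. \<not> wcong N (h k j) wone} \<subseteq> {}"
      by auto
    from wcong_sym[OF P[OF _ _ this]] show ?thesis
      by (simp add: one_witt_ring)
  qed
  have unit: "x \<in> Units (witt_ring p)" if "wcong 1 x wone" for x :: "nat \<Rightarrow> 'k fls"
  proof -
    have "x 0 $$ 0 = 1"
      using that by (auto simp: wcong_def fls_icong_def fls_cong_def dest!: spec[of _ 0])
    then show ?thesis
      by (auto simp: Units_witt_ring_iff[OF p char])
  qed
  have "h k j \<in> Units (witt_ring p)" if "0 < j" for k j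
    using that p1 by (intro unit h_cong) (simp flip: of_nat_mult of_nat_power)
  moreover have P_unit: "P k \<in> Units (witt_ring p)" for k
    using p1 by (intro unit P_cong) simp
  ultimately have P_prod: "witt_has_prod p (h k) ?J (P k)" for k
    using P_lim by (auto simp: witt_has_prod_def)

  have bad_k: "{k\<in>{0..}. \<not> wcong N (P k) wone} \<subseteq> {..<nat N}" for N
  proof -
    have "k < p ^ k" for k
      using p1 by (intro power_gt_expt) simp
    then have "N \<le> int (p ^ k)" if "nat N \<le> k" for k
      using that by (metis less_imp_le nat_le_iff order_trans)
    then have "wcong N (P k) wone" if "nat N \<le> k" for k
      using that P_cong by blast
    then show ?thesis
      by (auto simp flip: not_le)
  qed
  have fin_k: "finite {k\<in>{0..}. \<not> wcong N (P k) wone}" for N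
    by (rule finite_subset[OF bad_k]) simp
  obtain A where A: "\<And>N F. finite F \<Longrightarrow> F \<subseteq> {0..} \<Longrightarrow> {k\<in>{0..}. \<not> wcong N (P k) wone} \<subseteq> F \<Longrightarrow>
      wcong N (finprod (witt_ring p) P F) A"
    using integral_family_converges[OF p _ fin_k] P_cong[of 0] by auto
  have A_lim: "((\<lambda>F. finprod (witt_ring p) P F n) \<longlongrightarrow> A n) (finite_subsets_at_top {0..})" for n
    by (rule tendsto_finite_subsets_wcong[OF fin_k A])
  have "A = teichmueller g"
  proof (rule weqI_wcong)
    fix N :: nat
    let ?JN = "{j\<in>?J. j < N}"
    \<comment> \<open>Modulo \<open>T^N\<close> both products may be cut off at \<open>N\<close>.
      The exponents of this box include all of \<open>{1..<N}\<close>, each exactly once by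
      injectivity.\<close>
    define S where "S = (\<lambda>(k, j). j * p ^ k) ` ({..<N} \<times> ?JN)"
    have "finite S"
      by (simp add: S_def)
    have "{1..<N} \<subseteq> S"
    proof
      fix n assume n: "n \<in> {1..<N}"
      then have "0 < n"
        by simp
      from coprime_times_prime_power_cover[OF p this]
      obtain k j where kj: "n = j * p ^ k" "0 < j" "coprime j p" "k < n" "j \<le> n"
        by blast
      have "k < N" "j < N"
        using n kj(4,5) unfolding atLeastLessThan_iff by linarith+
      with kj(1-3) show "n \<in> S"
        unfolding S_def by (intro image_eqI[of _ _ "(k, j)"]) auto
    qed
    have "(\<Prod>k<N. \<Prod>j\<in>?JN. unit_monom a (j * p ^ k)) =
        (\<Prod>(k, j)\<in>{..<N} \<times> ?JN. unit_monom a (j * p ^ k))"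
      by (rule prod.cartesian_product)
    also have "\<dots> = (\<Prod>n\<in>S. unit_monom a n)"
    proof -
      have "inj_on (\<lambda>(k, j). j * p ^ k) ({..<N} \<times> ?JN)"
        by (rule inj_on_subset[OF coprime_times_prime_power_inj[OF p]]) auto
      then show ?thesis
        unfolding S_def by (simp add: prod.reindex case_prod_unfold)
    qed
    also have "\<dots> = (\<Prod>n\<in>{1..<N}. unit_monom a n) * (\<Prod>n\<in>S - {1..<N}. unit_monom a n)"
      using \<open>{1..<N} \<subseteq> S\<close> \<open>finite S\<close> by (metis prod.subset_diff mult.commute)
    finally have prod_eq: "(\<Prod>k<N. \<Prod>j\<in>?JN. unit_monom a (j * p ^ k)) =
        (\<Prod>n\<in>{1..<N}. unit_monom a n) * (\<Prod>n\<in>S - {1..<N}. unit_monom a n)" .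
    \<comment> \<open>With 0 excluded, the surplus exponents in \<open>S\<close> are at least
      \<open>N\<close>, and their factors are 1 modulo \<open>T^N\<close>.\<close>
    have "0 \<notin> S"
      using p1 by (auto simp: S_def)
    then have "N \<le> n" if "n \<in> S - {1..<N}" for n
      using that by (cases n) auto
    then have "fls_icong (int N) (\<Prod>n\<in>S - {1..<N}. unit_monom a n) (\<Prod>n\<in>S - {1..<N}. 1)"
      by (intro fls_icong_prod fls_icong_mono[OF fls_icong_unit_monom]) auto
    from fls_icong_mult[OF a[of N] this]
    have "fls_icong (int N) (\<Prod>k<N. \<Prod>j\<in>?JN. unit_monom a (j * p ^ k)) g"
      by (simp only: prod_eq prod.neutral_const mult_1_right)
    then have "wcong (int N) (teichmueller (\<Prod>k<N. \<Prod>j\<in>?JN. unit_monom a (j * p ^ k))) (teichmueller g)"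
      by (rule wcong_teichmueller)
    moreover have "finprod (witt_ring p) (\<lambda>k. finprod (witt_ring p) (h k) ?JN) {..<N} =
        teichmueller (\<Prod>k<N. \<Prod>j\<in>?JN. unit_monom a (j * p ^ k))"
      by (simp only: h_def[abs_def] finprod_teichmueller[OF p])
    ultimately have to_g: "wcong (int N)
        (finprod (witt_ring p) (\<lambda>k. finprod (witt_ring p) (h k) ?JN) {..<N}) (teichmueller g)"
      by simp
    have to_P: "wcong (int N) (finprod (witt_ring p) (\<lambda>k. finprod (witt_ring p) (h k) ?JN) {..<N})
        (finprod (witt_ring p) P {..<N})"
      using bad_j[of "int N"] by (intro wcong_finprod[OF p] P) auto
    have "wcong (int N) (finprod (witt_ring p) P {..<N}) A"
      using bad_k[of "int N"] by (intro A) auto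
    from wcong_trans[OF wcong_sym[OF wcong_trans[OF to_P this]] to_g]
    show "wcong (int N) A (teichmueller g)" .
  qed
  moreover have "teichmueller g \<in> Units (witt_ring p)"
    using g unit[of "teichmueller g"] wcong_teichmueller[OF g] by (simp add: wone_eq_teichmueller)
  ultimately have "witt_has_prod p P {0..} (teichmueller g)"
    using A_lim P_unit by (auto simp: witt_has_prod_def)
  with P_prod show ?thesis
    using that[of "\<lambda>j k. a (j * p ^ k)" P] by (simp only: h_eq)
qed

lemma one_below_witt_u_expansion:
  fixes y :: "nat \<Rightarrow> 'k::{field,finite} fls"
  assumes p: "prime p" and card: "CARD('k) = p" and y: "one_below 1 y"
  obtains e b Q where
    "\<And>i1 i2. e i1 i2 \<in> {0..p - 1}"
    "\<And>i2. i2 \<ge> 2 \<Longrightarrow> witt_has_prod p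
       (\<lambda>i1. witt_u p i1 i2 [^]\<^bsub>witt_ring p\<^esub> (e i1 i2 :: nat)) {b i2..} (Q i2)"
    "witt_has_prod p Q {2..} y"
proof -
  have char: "of_nat p = (0 :: 'k fls)"
    using of_nat_CARD_eq_0[where 'a = 'k] card by (simp add: fls_of_nat)
  interpret comm_monoid "witt_ring p :: (nat \<Rightarrow> 'k fls) ring"
    by (rule comm_monoid_witt_ring) fact
  \<comment> \<open>One step of the iteration: a remainder \<open>r\<close> in
    \<open>1 + V^(n+1) W\<close> is split into a product \<open>q\<close> of the \<open>u\<close>
    with second index \<open>n + 2\<close> and a remainder \<open>s\<close> one level
    deeper.\<close>
  define D where "D n r e b q s \<longleftrightarrow> (\<forall>i. e i \<in> {0..p - 1}) \<and>
      witt_has_prod p (\<lambda>i. witt_u p i (n + 2) [^]\<^bsub>witt_ring p\<^esub> (e i :: nat)) {b..} q \<and>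
      one_below (Suc n) q \<and> r = wmult p q s \<and> one_below (Suc (Suc n)) s"
    for n e b and r q s :: "nat \<Rightarrow> 'k fls"
  have "\<exists>e b q s. D n r e b q s" if r: "one_below (Suc n) r" for n r
  proof -
    obtain e b q where q: "\<And>i. e i \<in> {0..p - 1}"
      "witt_has_prod p (\<lambda>i. witt_u p i (Suc (Suc n)) [^]\<^bsub>witt_ring p\<^esub> (e i :: nat)) {b..} q"
      "one_below (Suc n) q" "q (Suc n) = r (Suc n)"
      by (rule witt_u_product[OF p card, of "Suc n" r]) auto
    obtain s where "r = wmult p q s" "one_below (Suc (Suc n)) s"
      by (rule one_below_Suc_quotient[OF p char _ q(3) r q(4)]) auto
    with q have "D n r e b q s"
      by (simp add: D_def)
    then show ?thesis
      by blast
  qed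
  then obtain E B q s where
    "\<And>n r. one_below (Suc n) r \<Longrightarrow> D n r (E n r) (B n r) (q n r) (s n r)"
    by metis
  note step = this[unfolded D_def]
  \<comment> \<open>\<open>R n\<close> is what remains of \<open>y\<close> after dividing by the
    first \<open>n\<close> factors \<open>Q 2, ..., Q (n + 1)\<close>.\<close>
  define R where "R = rec_nat y s"
  have R_simps: "R 0 = y" "R (Suc n) = s n (R n)" for n
    by (simp_all add: R_def)
  have R: "one_below (Suc n) (R n)" for n
    by (induction n) (use y step in \<open>auto simp: R_simps\<close>)
  define Q where "Q i = q (i - 2) (R (i - 2))" for i
  have Q_below: "one_below (i - 1) (Q i)" if "2 \<le> i" for i
  proof -
    have "Suc (i - 2) = i - 1"
      using that by simp
    then show ?thesis
      using step[OF R[of "i - 2"]] by (simp add: Q_def)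
  qed
  have partial: "wmult p (finprod (witt_ring p) Q {2..<2 + n}) (R n) = y" for n
  proof (induction n)
    case 0
    show ?case
      by (simp add: R_simps one_witt_ring wmult_one[OF p])
  next
    case (Suc n)
    have "{2..<2 + Suc n} = insert (2 + n) {2..<2 + n}"
      by auto
    then have "finprod (witt_ring p) Q {2..<2 + Suc n} =
        wmult p (Q (2 + n)) (finprod (witt_ring p) Q {2..<2 + n})"
      by simp
    also have "\<dots> = wmult p (finprod (witt_ring p) Q {2..<2 + n}) (Q (2 + n))"
      by (rule wmult_commute[OF p])
    finally have "finprod (witt_ring p) Q {2..<2 + Suc n} =
        wmult p (finprod (witt_ring p) Q {2..<2 + n}) (Q (2 + n))" .
    moreover have "R n = wmult p (Q (2 + n)) (R (Suc n))"
      using step[OF R[of n]] by (simp add: Q_def R_simps)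
    ultimately show ?case
      using Suc by (simp add: wmult_assoc[OF p])
  qed
  have "witt_has_prod p Q {2..} y"
  proof (rule witt_has_prod_eventually_eq[OF p char])
    show "Q i 0 \<noteq> 0" if "2 \<le> i" for i
      using Q_below[OF that] that by (auto simp: one_below_def)
    show "y 0 \<noteq> 0"
      using y by (simp add: one_below_def)
    show "one_below (Suc n) (Q i)" if "2 + n \<le> i" for n i
      using that by (intro one_below_mono[OF Q_below]) auto
    \<comment> \<open>The remainder \<open>R n\<close> is 1 up to and including component
      \<open>n\<close>, so multiplying by it does not alter that component.\<close>
    show "finprod (witt_ring p) Q {2..<2 + n} n = y n" for n
      using wmult_one_below_left[OF p R[of n]] partial[of n] by metis
  qed
  moreover have "E (i2 - 2) (R (i2 - 2)) i1 \<in> {0..p - 1}" for i1 i2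
    using step[OF R] by blast
  moreover have "witt_has_prod p
      (\<lambda>i1. witt_u p i1 i2 [^]\<^bsub>witt_ring p\<^esub> E (i2 - 2) (R (i2 - 2)) i1) {B (i2 - 2) (R (i2 - 2))..} (Q i2)"
    if "2 \<le> i2" for i2
  proof -
    have "i2 - 2 + 2 = i2"
      using that by simp
    with step[OF R[of "i2 - 2"]] show ?thesis
      by (simp only: Q_def)
  qed
  ultimately show ?thesis
    using that[of "\<lambda>i1 i2. E (i2 - 2) (R (i2 - 2)) i1" "\<lambda>i2. B (i2 - 2) (R (i2 - 2))" Q] by blast
qed

text \<open>The nested products are expressed by naming their values: \<open>P k\<close> and
  \<open>Q i2\<close> for the inner ones, \<open>A\<close> and \<open>B\<close> for the outer ones,
  each with its own convergence claim.\<close>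

theorem theorem3p2:
  fixes p :: nat and x :: "nat \<Rightarrow> 'k::{field,finite} fls"
  assumes "prime p" and "CARD('k) = p"
    and "x \<in> Units (witt_ring p)"
  shows "\<exists>(c :: 'k) (cc :: nat \<Rightarrow> nat \<Rightarrow> 'k) (e :: int \<Rightarrow> nat \<Rightarrow> nat) (b :: nat \<Rightarrow> int) P A Q B.
    c \<noteq> 0 \<and>
    (\<forall>i2\<ge>2. \<forall>i1\<ge>b i2. e i1 i2 \<in> {0..p - 1}) \<and>
    (\<forall>k. witt_has_prod p
       (\<lambda>j. teichmueller (1 - fls_const (cc j k) * fls_X ^ j) [^]\<^bsub>witt_ring p\<^esub> (p ^ k))
       {j. 0 < j \<and> coprime j p} (P k)) \<and>
    witt_has_prod p P {0..} A \<and>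
    (\<forall>i2\<ge>2. witt_has_prod p
       (\<lambda>i1. witt_u p i1 i2 [^]\<^bsub>witt_ring p\<^esub> e i1 i2) {b i2..} (Q i2)) \<and>
    witt_has_prod p Q {2..} B \<and>
    x = teichmueller (fls_const c * fls_X powi fls_subdegree (x 0))
          \<otimes>\<^bsub>witt_ring p\<^esub> A \<otimes>\<^bsub>witt_ring p\<^esub> B"
proof -
  note p = assms(1) and card = assms(2)
  have char: "of_nat p = (0 :: 'k fls)"
    using of_nat_CARD_eq_0[where 'a = 'k] card by (simp add: fls_of_nat)
  have x0: "x 0 \<noteq> 0"
    using assms(3) by (simp add: Units_witt_ring_iff[OF p char])
  obtain c g where c: "c \<noteq> 0" and x0_eq: "x 0 = fls_const c * fls_X powi fls_subdegree (x 0) * g"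
    and g: "fls_icong 1 g 1"
    using principal_unit_normalization[OF x0] by blast
  obtain cc P where cc: "\<And>k. witt_has_prod p
       (\<lambda>j. teichmueller (1 - fls_const (cc j k) * fls_X ^ j) [^]\<^bsub>witt_ring p\<^esub> (p ^ k))
       {j. 0 < j \<and> coprime j p} (P k)"
    and P: "witt_has_prod p P {0..} (teichmueller g)"
    using teichmueller_principal_unit_expansion[OF p card g] by blast
  \<comment> \<open>Dividing by the lift of all of \<open>x 0\<close> gives leading component 1, so
    \<open>y\<close> is left to the \<open>u\<close> factors and \<open>A\<close> is exactly the
    lift of the principal unit \<open>g\<close>.\<close>
  define y where "y = wmult p (teichmueller (inverse (x 0))) x"
  have "one_below 1 y"
    using x0 by (simp add: one_below_def y_def wmult_0[OF p] teichmueller_def)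
  then obtain e b Q where e: "\<And>i1 i2. e i1 i2 \<in> {0..p - 1}"
    and Q: "\<And>i2. i2 \<ge> 2 \<Longrightarrow> witt_has_prod p
       (\<lambda>i1. witt_u p i1 i2 [^]\<^bsub>witt_ring p\<^esub> (e i1 i2 :: nat)) {b i2..} (Q i2)"
    and y: "witt_has_prod p Q {2..} y"
    using one_below_witt_u_expansion[OF p card] by blast
  have "wmult p (wmult p (teichmueller (fls_const c * fls_X powi fls_subdegree (x 0)))
      (teichmueller g)) y = wmult p (teichmueller (x 0)) y"
    by (simp only: wmult_teichmueller[OF p] flip: x0_eq)
  also have "\<dots> = wmult p (teichmueller 1) x"
    using x0 by (simp add: y_def wmult_teichmueller[OF p] flip: wmult_assoc[OF p])
  also have "\<dots> = x"
    by (simp add: wmult_one[OF p] flip: wone_eq_teichmueller)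
  finally have "x = wmult p (wmult p (teichmueller (fls_const c * fls_X powi fls_subdegree (x 0)))
      (teichmueller g)) y" ..
  then show ?thesis
    using c e cc P Q y
    by (intro exI[of _ c] exI[of _ cc] exI[of _ e] exI[of _ b] exI[of _ P] exI[of _ "teichmueller g"]
        exI[of _ Q] exI[of _ y] conjI allI impI)
qed

end
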